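(* Let $x_1,x_2,x_3,v_+,u',u''$ be independent variables and put $x_+=\tfrac13(x_1+x_2+x_3)$, $u_+=x_+$, $u_1=u_++u'$, $u_2=u_++u''$, $u_3=u_+-u'-u''$ (so $u_1+u_2+u_3=x_1+x_2+x_3$), $t_i=x_i-u_1$ ($i=1,2,3$), $s=u_2-u_1$. On an open set where a holomorphic choice $z^*=z^*(\vec t,s)$ of a stationary point $\partial_z\varkappa(\vec t,s|z)|_{z=z^*}=0$ with $\varkappa(\vec t,s|z^* )\neq0$ is fixed, set $\overline{\mathcal F}=\log\varkappa(\vec t,s|z^* )$ and $$\mathcal F(v_+,u',u'';x_1,x_2,x_3)=v_+x_++ig\log\frac{\prod_{i=1}^3\sigma(x_i)}{\prod_{i=1}^3\sigma(u_i)\prod_{i<j}\sigma(x_i-x_j)}+ig\,\overline{\mathcal F},$$ with $g$ a nonzero constant. Define $y_i=\partial\mathcal F/\partial x_i$ ($i=1,2,3$), $v'=-\partial\mathcal F/\partial u'$, $v''=-\partial\mathcal F/\partial u''$, and $v_1,v_2,v_3$ by $v_1+v_2+v_3=v_+$, $v_1-v_3=v'$, $v_2-v_3=v''$. Let $\bar y_i=\partial\overline{\mathcal F}/\partial x_i$ (at fixed $v_+,u',u''$) and $r_\alpha=\bar y_\alpha-\bar y_3$, $\alpha=1,2$. Then: (a) $y_1dx_1+y_2dx_2+y_3dx_3-v_+du_+-v'du'-v''du''=d(\mathcal F-v_+u_+)$, i.e. $(x_1,x_2,x_3,y_1,y_2,y_3)\mapsto(u_+,u',u'';v_+,v',v'')$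 is a canonical transformation; (b) $\mathfrak B(r_1,r_2|\vec x,u_j)=0$ for $j=1,2,3$; (c) for $j=1,2,3$, $$v_j=y_1+ig\Big[\zeta(x_3-u_j)+\zeta(u_j)-\zeta(x_1)+\zeta(x_1-x_3)+\frac{\tilde r_1(u_j)}{\tilde r_2(u_j)}\big(\zeta(u_j-x_3)-\zeta(u_j-x_2)+\zeta(x_1-x_2)-\zeta(x_1-x_3)\big)\Big],$$ where $\tilde r_\alpha(u)=r_\alpha+2\zeta(u-x_\alpha)-2\zeta(u-x_3)$. Thus $\mathcal F$ is the generating function of the separating canonical transformation for the $A_3$ (four-particle) elliptic Calogero–Moser system: $u_1,u_2,u_3$ are the separated coordinates (zeros of $\mathfrak B$) and $v_j$ the corresponding conjugate momenta.
   Context: $\sigma,\zeta$ are the Weierstrass functions with periods $2\omega_1,2\omega_2$, $\zeta=\sigma'/\sigma$. $\varkappa(\vec t,s|z)=\frac{\sigma(z)\sigma(z+s)}{\sigma^2(2z+s)}\prod_{i=1}^3\sigma(z+t_i)\sigma(z+s-t_i)$. For $\vec x=(x_1,x_2,x_3)$, $u$ and numbers $r_1,r_2$, set $\tilde r_\alpha=r_\alpha+2[\zeta(x_3-u)-\zeta(x_\alpha-u)]$ ($\alpha=1,2$) and $\mathfrak B(r_1,r_2|\vec x,u)=\tilde r_1\tilde r_2(\tilde r_1-\tilde r_2)+2\tilde r_1\tilde r_2[\zeta(x_1-u)-\zeta(x_2-u)-\zeta(x_1-x_2)]+\tilde r_1^2[\zeta(x_1-x_2)+\zeta(x_2-u)-\zeta(x_1-x_3)-\zeta(x_3-u)]+\tilde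 r_2^2[\zeta(x_1-x_2)-\zeta(x_1-u)+\zeta(x_2-x_3)+\zeta(x_3-u)]$. Background: the four-particle elliptic Calogero–Moser system has canonical variables $q_i,p_i$ and Lax matrix $\mathcal L(u)_{ii}=p_i$, $\mathcal L(u)_{ij}=-ig\,\sigma(u+q_i-q_j)/(\sigma(u)\sigma(q_i-q_j))$ ($i\ne j$); with $x_i=q_i-q_4$, $y_i=p_i$ ($i\le3$), the separated variables are the zeros $u_j$ of the determinant of the $4\times4$ matrix with rows $(\mathcal L^k)_{4,\cdot}$, $k=0,1,2,3$, and $v_j$ is determined by $(\mathcal L(u_j)-v_j)^{\mathrm{adj}}_{4k}=0$; conditions (b) and (c) are the explicit form of these requirements in the reduced variables. *)

theory Defs
  imports "HOL-Analysis.Analysis"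
begin

definition wlattice :: "complex \<Rightarrow> complex \<Rightarrow> complex set" where
  "wlattice w1 w2 = {2 * of_int m * w1 + 2 * of_int n * w2 | m n. True}"

definition wzeta :: "complex \<Rightarrow> complex \<Rightarrow> complex \<Rightarrow> complex" where
  "wzeta w1 w2 z = 1 / z +
     infsum (\<lambda>w. 1 / (z - w) + 1 / w + z / w\<^sup>2) (wlattice w1 w2 - {0})"

text \<open>Weierstrass sigma: the canonical product
  z * prod' (1 - z/w) exp(z/w + z^2/(2 w^2)), written as z * exp of the
  absolutely convergent sum of the logarithms of the factors.\<close>
definition wsigma :: "complex \<Rightarrow> complex \<Rightarrow> complex \<Rightarrow> complex" where
  "wsigma w1 w2 z = (if z \<in> wlattice w1 w2 then 0 else
     z * exp (infsum (\<lambda>w. Ln (1 - z / w) + z / w + z\<^sup>2 / (2 * w\<^sup>2)) (wlattice w1 w2 - {0})))"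

definition kappa :: "complex \<Rightarrow> complex \<Rightarrow> complex \<Rightarrow> complex \<Rightarrow> complex \<Rightarrow> complex \<Rightarrow> complex \<Rightarrow> complex" where
  "kappa w1 w2 t1 t2 t3 s z =
     wsigma w1 w2 z * wsigma w1 w2 (z + s) / (wsigma w1 w2 (2 * z + s))\<^sup>2 *
     (\<Prod>t\<leftarrow>[t1, t2, t3]. wsigma w1 w2 (z + t) * wsigma w1 w2 (z + s - t))"

definition frakB :: "complex \<Rightarrow> complex \<Rightarrow> complex \<Rightarrow> complex \<Rightarrow> complex \<Rightarrow> complex \<Rightarrow> complex \<Rightarrow> complex \<Rightarrow> complex" where
  "frakB w1 w2 r1 r2 x1 x2 x3 u =
     (let Z = wzeta w1 w2;
          rt1 = r1 + 2 * (Z (x3 - u) - Z (x1 - u));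
          rt2 = r2 + 2 * (Z (x3 - u) - Z (x2 - u))
      in rt1 * rt2 * (rt1 - rt2)
         + 2 * rt1 * rt2 * (Z (x1 - u) - Z (x2 - u) - Z (x1 - x2))
         + rt1\<^sup>2 * (Z (x1 - x2) + Z (x2 - u) - Z (x1 - x3) - Z (x3 - u))
         + rt2\<^sup>2 * (Z (x1 - x2) - Z (x1 - u) + Z (x2 - x3) + Z (x3 - u)))"

definition cpartial :: "(complex^'n \<Rightarrow> complex) \<Rightarrow> 'n \<Rightarrow> complex^'n \<Rightarrow> complex" where
  "cpartial F k p = deriv (\<lambda>w. F (p + w *s axis k 1)) 0"

definition holo_on :: "(complex^'n \<Rightarrow> complex) \<Rightarrow> (complex^'n) set \<Rightarrow> bool" where
  "holo_on f S \<longleftrightarrow> open S \<and> f differentiable_on S \<and>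
     (\<forall>p\<in>S. \<forall>k. (\<lambda>w. f (p + w *s axis k 1)) field_differentiable (at 0))"

section \<open>Coordinates (x1,x2,x3,u',u'',v+) on complex^6\<close>

definition xplus :: "complex^6 \<Rightarrow> complex" where
  "xplus p = (p$1 + p$2 + p$3) / 3"

definition uplus :: "complex^6 \<Rightarrow> complex" where
  "uplus p = xplus p"

definition uu1 :: "complex^6 \<Rightarrow> complex" where "uu1 p = uplus p + p$4"
definition uu2 :: "complex^6 \<Rightarrow> complex" where "uu2 p = uplus p + p$5"
definition uu3 :: "complex^6 \<Rightarrow> complex" where "uu3 p = uplus p - p$4 - p$5"

definition uu :: "nat \<Rightarrow> complex^6 \<Rightarrow> complex" where
  "uu j p = (if j = 1 then uu1 p else if j = 2 then uu2 p else uu3 p)"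

definition tsv :: "complex^6 \<Rightarrow> complex^4" where
  "tsv p = vector [p$1 - uu1 p, p$2 - uu1 p, p$3 - uu1 p, uu2 p - uu1 p]"

end

theory Submission
  imports Defs "HOL-Complex_Analysis.Complex_Analysis"
begin

text \<open>Let $z$ be the stationary point, shift all points by $z - u_1$ and write $a_i = z + t_i$,
  $a = z$, $b = z + s$, $c = a + b$. Stationarity says that $\zeta(p) + \zeta(c - p) - \zeta(c)$ sums
  to zero over $p \in \{a, a_1, a_2, a_3\}$: four chords of the Weierstrass cubic through the point
  $-c$ have slopes with vanishing sum. Fix $u$ among the $u_j$ and put
  $T_{ij} = \zeta(x_i - u) - \zeta(x_j - u) - \zeta(x_i - x_j)$. There are explicit $\rho_i$ with
  $\tilde r_\alpha = \rho_3 - \rho_\alpha$, and the addition law of $\zeta$ gives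
  $2 T_{ij} (\rho_i - \rho_j) = \rho_i^2 + \rho_j^2 - \rho_i \rho_j + K$ with the same $K$ for all
  pairs; for $u_1$ and $u_2$ this uses stationarity, for $u_3$ it holds unconditionally. The vanishing
  of $\mathfrak B$ and the formula for $v_j$ are polynomial consequences of these three relations.
  The derivative of $z$ itself drops out of the derivatives of the generating function, again by
  stationarity.\<close>

text \<open>With m_i = zeta(a_i) - zeta(c - a_i), the partial derivatives of \<open>Fb\<close> give
  r_\<alpha> = m_\<alpha> - m_3, so the shifted values prescribe rho_i = 2 zeta(x_i - u) - m_i only
  up to a common constant. That constant is the real unknown: it is zeta(a) - zeta(b) for u_1,
  zeta(b) - zeta(a) for u_2, and m_1 + m_2 + m_3 for u_3. With it, each rho_i is a sum of two
  expressions zeta(p) + zeta(q) - zeta(p + q), to which the addition law applies. The shift sends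
  u_1, u_2, u_3 to a, b and a_1 + a_2 + a_3 - c; exchanging a and b preserves c, the m_i and
  stationarity, so the case u_2 follows from the case u_1. The analytic obstacle is the choice of
  branches: sigma is defined through principal logarithms, which jump, while \<open>L\<close> and
  \<open>Fb\<close> are arbitrary continuous logarithms. Derivatives are therefore carried as value
  times logarithmic derivative, and a branch is taken only locally at the end.\<close>

unbundle no Formal_Power_Series.fps_syntax

section \<open>Preliminaries\<close>

text \<open>The exponent is half of the 3 in the lattice sum, which will be dominated by a product
  of two such series.\<close>

lemma summable_on_int_powr: "(\<lambda>m::int. (1 + \<bar>real_of_int m\<bar>) powr (-3/2)) summable_on UNIV"
proof -
  have "summable (\<lambda>n. real (Suc n) powr (-3/2))"
    using summable_real_powr_iff[of "-3/2"] by (subst summable_Suc_iff) simp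
  then have nat: "(\<lambda>n. (1 + real n) powr (-3/2)) summable_on UNIV"
    by (intro norm_summable_imp_summable_on) (simp add: add.commute)
  have "(\<lambda>m::int. (1 + \<bar>real_of_int m\<bar>) powr (-3/2)) summable_on range int"
    using nat by (subst summable_on_reindex) (auto simp: o_def)
  moreover have "(\<lambda>m::int. (1 + \<bar>real_of_int m\<bar>) powr (-3/2)) summable_on range (\<lambda>n. - int n)"
    using nat by (subst summable_on_reindex) (auto simp: o_def inj_on_def)
  ultimately have "(\<lambda>m::int. (1 + \<bar>real_of_int m\<bar>) powr (-3/2)) summable_on (range int \<union> range (\<lambda>n. - int n))"
    by (rule summable_on_union)
  moreover have "range int \<union> range (\<lambda>n. - int n) = UNIV"
    by (auto intro: int_cases2)
  ultimately show ?thesis by simp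
qed

text \<open>Logarithmic derivatives add. Writing each derivative as \<open>f i z * d i\<close>
  avoids dividing by a factor that might vanish.\<close>

lemma has_field_derivative_prod_log:
  fixes f :: "'i \<Rightarrow> complex \<Rightarrow> complex"
  assumes "finite S" "\<And>i. i \<in> S \<Longrightarrow> (f i has_field_derivative f i z * d i) (at z)"
  shows "((\<lambda>z. \<Prod>i\<in>S. f i z) has_field_derivative (\<Prod>i\<in>S. f i z) * (\<Sum>i\<in>S. d i)) (at z)"
  using assms
proof (induction S rule: finite_induct)
  case (insert i S)
  have "((\<lambda>z. f i z * (\<Prod>i\<in>S. f i z)) has_field_derivative
          f i z * d i * (\<Prod>i\<in>S. f i z) + (\<Prod>i\<in>S. f i z) * (\<Sum>i\<in>S. d i) * f i z) (at z)"
    by (intro DERIV_mult insert) auto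
  then show ?case using insert.hyps by (simp add: algebra_simps)
qed simp

lemma tendsto_pole_times_zero:
  fixes F G :: "complex \<Rightarrow> complex"
  assumes "(\<lambda>z. (z - s) * F z) \<midarrow>s\<rightarrow> r" "(G has_field_derivative d) (at s)" "G s = 0"
  shows "(\<lambda>z. F z * G z) \<midarrow>s\<rightarrow> r * d"
proof -
  have "(\<lambda>z. (G z - G s) / (z - s)) \<midarrow>s\<rightarrow> d"
    using assms(2) by (simp add: has_field_derivative_iff)
  from tendsto_mult[OF assms(1) this] show ?thesis
    by (rule Lim_transform_eventually) (auto simp: eventually_at_filter assms(3))
qed

lemma holomorphic_on_imp_isCont:
  "f holomorphic_on U \<Longrightarrow> open U \<Longrightarrow> a \<in> U \<Longrightarrow> isCont f a"
  using holomorphic_on_imp_continuous_on continuous_on_eq_continuous_at by blast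

section \<open>Polynomial identities behind the separation relations\<close>

text \<open>Collecting the \<open>T\<close>'s, the first expression is (r3 - r1)(r3 - r2)(r2 - r1) -
  (r1 - r2)^2 T12 + (r1 - r3)^2 T13 - (r2 - r3)^2 T23. Inserting the relations, \<open>K\<close>
  cancels because (r1 - r2) + (r2 - r3) = r1 - r3, and the remaining cubics cancel the Vandermonde
  product. The second identity is the difference of \<open>a\<close> and \<open>b\<close>.\<close>

lemma separation_algebra:
  fixes r1 r2 r3 T12 T13 T23 K :: complex
  assumes a: "2 * T12 * (r1 - r2) = r1\<^sup>2 + r2\<^sup>2 - r1 * r2 + K"
    and b: "2 * T13 * (r1 - r3) = r1\<^sup>2 + r3\<^sup>2 - r1 * r3 + K"
    and c: "2 * T23 * (r2 - r3) = r2\<^sup>2 + r3\<^sup>2 - r2 * r3 + K"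
  shows "(r3 - r1) * (r3 - r2) * (r2 - r1) + 2 * (r3 - r1) * (r3 - r2) * T12
           + (r3 - r1)\<^sup>2 * (T13 - T12) - (r3 - r2)\<^sup>2 * (T12 + T23) = 0" (is "?X = 0")
    and "(r3 - r2) * (r1 - r2 - r3 - 2 * T12) = 2 * (r3 - r1) * (T13 - T12)"
proof -
  have "2 * ?X = 0" using a b c by algebra
  then show "?X = 0" by (simp only: mult_eq_0_iff) simp
  show "(r3 - r2) * (r1 - r2 - r3 - 2 * T12) = 2 * (r3 - r1) * (T13 - T12)"
    using a b by algebra
qed

text \<open>Put D_i = M_i - A_i. Adding the first two hypotheses and eliminating P1, P2 leaves 4 A_i
  M_i and -4 l (D_1 + D_2). The last hypothesis replaces -4 l by D_1 + D_2 + D_3, and 4 A_i M_i +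
  D_i^2 = (A_i + M_i)^2. What remains is symmetric in the D_i, hence the same for every
  pair.\<close>

lemma relation_first_algebra:
  fixes A1 A2 A3 M1 M2 M3 P1 P2 pa pb l T12 :: complex
  assumes "T12 * (A1 - A2) = P1 + P2 + pa - A1 * A2"
    and "T12 * (M1 - M2) = P1 + P2 + pb - M1 * M2"
    and "P1 = A1 * M1 - l * (M1 - A1) - pa - pb"
    and "P2 = A2 * M2 - l * (M2 - A2) - pa - pb"
    and "4 * l + (M1 - A1) + (M2 - A2) + (M3 - A3) = 0"
  shows "2 * T12 * ((A1 + M1) - (A2 + M2)) =
    (A1 + M1)\<^sup>2 + (A2 + M2)\<^sup>2 - (A1 + M1) * (A2 + M2)
      + ((M1 - A1) * (M2 - A2) + (M1 - A1) * (M3 - A3) + (M2 - A2) * (M3 - A3) - 6 * (pa + pb))"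
  using assms by algebra

text \<open>The same elimination as in \<open>relation_first_algebra\<close>, but the differences of
  the paired slopes are known outright as l3 - l2 and l3 - l1. Up to an additive constant,
  \<open>q\<close> is the value of the Weierstrass p function at c.\<close>

lemma relation_third_algebra:
  fixes F12 F13 F21 F23 P1 P2 l1 l2 l3 q pa3 pb3 T12 :: complex
  assumes "T12 * (F13 - F23) = P1 + P2 + pa3 - F13 * F23"
    and "T12 * (F12 - F21) = P1 + P2 + pb3 - F12 * F21"
    and "P1 = F12 * F13 - l2 * (F13 - F12) - (l2\<^sup>2 - q)"
    and "P2 = F21 * F23 - l1 * (F23 - F21) - (l1\<^sup>2 - q)"
    and "F13 - F12 = l3 - l2" "F23 - F21 = l3 - l1" "pa3 + pb3 = l3\<^sup>2 - q"
  shows "2 * T12 * ((F12 + F13) - (F21 + F23)) =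
    (F12 + F13)\<^sup>2 + (F21 + F23)\<^sup>2 - (F12 + F13) * (F21 + F23)
      + (6 * q - (l1\<^sup>2 + l2\<^sup>2 + l3\<^sup>2 + l1 * l2 + l1 * l3 + l2 * l3))"
proof -
  have e: "F13 = F12 - l2 + l3" "F23 = F21 - l1 + l3" using assms(5,6) by (simp_all add: algebra_simps)
  show ?thesis using assms(1-4,7) unfolding e by algebra
qed

section \<open>Logarithmic derivatives in several variables\<close>

lemma has_derivative_compose_field:
  fixes f :: "complex \<Rightarrow> complex"
  assumes "(f has_field_derivative d) (at (g p))" "(g has_derivative g') (at p)"
  shows "((\<lambda>q. f (g q)) has_derivative (\<lambda>h. d * g' h)) (at p)"
  using has_derivative_compose[OF assms(2)] assms(1) unfolding has_field_derivative_def .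

lemma has_derivative_mult_log:
  fixes F G :: "'a::real_normed_vector \<Rightarrow> complex"
  assumes "(F has_derivative (\<lambda>h. F p * D h)) (at p)" "(G has_derivative (\<lambda>h. G p * E h)) (at p)"
  shows "((\<lambda>q. F q * G q) has_derivative (\<lambda>h. F p * G p * (D h + E h))) (at p)"
  using has_derivative_mult[OF assms] by (simp add: algebra_simps)

lemma has_derivative_divide_log:
  fixes F G :: "'a::real_normed_vector \<Rightarrow> complex"
  assumes "(F has_derivative (\<lambda>h. F p * D h)) (at p)" "(G has_derivative (\<lambda>h. G p * E h)) (at p)" "G p \<noteq> 0"
  shows "((\<lambda>q. F q / G q) has_derivative (\<lambda>h. F p / G p * (D h - E h))) (at p)"
proof -
  have "(\<lambda>h. - F p * (inverse (G p) * (G p * E h) * inverse (G p)) + F p * D h / G p)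
      = (\<lambda>h. F p / G p * (D h - E h))"
    using assms(3) by (simp add: fun_eq_iff field_simps)
  with has_derivative_divide[OF assms(1,2,3)] show ?thesis by simp
qed

text \<open>Near \<open>p\<close> any continuous logarithm of \<open>F\<close> equals
  \<open>L p + Ln (F q / F p)\<close>, where \<open>Ln\<close> is evaluated near 1 and so is
  smooth.\<close>

lemma has_derivative_log_branch:
  fixes F L :: "'a::real_normed_vector \<Rightarrow> complex"
  assumes F: "(F has_derivative (\<lambda>h. F p * D h)) (at p)"
    and S: "open S" "p \<in> S" and L: "continuous_on S L" and exp: "\<And>q. q \<in> S \<Longrightarrow> exp (L q) = F q"
  shows "(L has_derivative D) (at p)"
proof -
  have Fp: "F p \<noteq> 0" using exp[OF S(2)] by (metis exp_not_eq_zero)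
  have "((\<lambda>q. F q / F p) has_derivative (\<lambda>h. F p * D h / F p)) (at p)"
    using has_derivative_mult_left[OF F, of "inverse (F p)"] by (simp add: divide_inverse)
  then have G: "((\<lambda>q. F q / F p) has_derivative D) (at p)" using Fp by simp
  have Ln1: "(Ln has_field_derivative 1) (at (F p / F p))"
    using has_field_derivative_Ln[of 1] Fp by simp
  have "((\<lambda>q. Ln (F q / F p)) has_derivative (\<lambda>h. 1 * D h)) (at p)"
    by (rule has_derivative_compose_field[OF Ln1 G])
  then have H: "((\<lambda>q. L p + Ln (F q / F p)) has_derivative D) (at p)"
    using has_derivative_add[OF has_derivative_const[of "L p"]] by fastforce
  \<comment> \<open>Distance below pi keeps \<open>L q - L p\<close> in the strip where
    \<open>Ln\<close> inverts \<open>exp\<close>.\<close>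
  have "isCont L p" using L S continuous_on_eq_continuous_at by blast
  then have "\<forall>\<^sub>F q in nhds p. dist (L q) (L p) < pi"
    using pi_gt_zero by (auto simp: continuous_at_eps_delta eventually_nhds_metric)
  moreover have "\<forall>\<^sub>F q in nhds p. q \<in> S" using S by (rule eventually_nhds_in_open)
  ultimately have "\<forall>\<^sub>F q in nhds p. L p + Ln (F q / F p) = L q"
  proof eventually_elim
    case (elim q)
    have "\<bar>Im (L q - L p)\<bar> < pi"
      using abs_Im_le_cmod[of "L q - L p"] elim(1) by (simp add: dist_norm)
    then have "Ln (exp (L q - L p)) = L q - L p" by (intro Ln_exp) auto
    then show ?case using exp[OF elim(2)] exp[OF S(2)] by (simp add: exp_diff)
  qed
  then obtain T where T: "open T" "p \<in> T" "\<And>q. q \<in> T \<Longrightarrow> L p + Ln (F q / F p) = L q"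
    unfolding eventually_nhds by blast
  show ?thesis
    by (rule has_derivative_transform_within_open[OF H T])
qed

text \<open>\<open>cpartial\<close> is a complex derivative, whereas \<open>F\<close> is
  differentiated over the reals; homogeneity of \<open>D\<close> under complex scalars is the
  Cauchy-Riemann condition that links them.\<close>

lemma cpartial_eq:
  fixes F :: "complex^'n \<Rightarrow> complex"
  assumes F: "(F has_derivative D) (at p)" and D: "\<And>w h. D (w *s h) = w * D h"
  shows "cpartial F k p = D (axis k 1)"
proof -
  have "linear (\<lambda>w::complex. w *s (axis k 1 :: complex^'n))"
    by (rule linearI) (simp_all add: vec_eq_iff algebra_simps)
  then have "bounded_linear (\<lambda>w::complex. w *s (axis k 1 :: complex^'n))"
    by (simp add: linear_conv_bounded_linear)
  then have "((\<lambda>w. p + w *s axis k 1) has_derivative (\<lambda>w. w *s axis k 1)) (at 0)"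
    using has_derivative_add[OF has_derivative_const[of p] bounded_linear_imp_has_derivative] by fastforce
  moreover have "(F has_derivative D) (at (p + 0 *s axis k 1))" using F by simp
  ultimately have "((\<lambda>w. F (p + w *s axis k 1)) has_derivative (\<lambda>w. D (w *s axis k 1))) (at 0)"
    by (rule has_derivative_compose)
  then have "((\<lambda>w. F (p + w *s axis k 1)) has_field_derivative D (axis k 1)) (at 0)"
    by (simp add: has_field_derivative_def D mult.commute[of _ "D (axis k 1)"])
  then show ?thesis unfolding cpartial_def by (rule DERIV_imp_deriv)
qed

section \<open>Coordinates and partial derivatives of a generating function\<close>

lemma linear_has_derivative:
  "linear f \<Longrightarrow> (f has_derivative f) (at p)" for f :: "'a::euclidean_space \<Rightarrow> 'b::real_normed_vector"
  by (simp add: linear_conv_bounded_linear bounded_linear_imp_has_derivative)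

lemma uu_simps: "uu 1 p = uu1 p" "uu 2 p = uu2 p" "uu 3 p = uu3 p"
  by (simp_all add: uu_def)

lemma frakB_translate: "frakB w1 w2 r1 r2 (x1 + w) (x2 + w) (x3 + w) (u + w) = frakB w1 w2 r1 r2 x1 x2 x3 u"
  by (simp add: frakB_def)

lemma tsv_nth:
  "tsv q $ 1 = q $ 1 - uu1 q" "tsv q $ 2 = q $ 2 - uu1 q" "tsv q $ 3 = q $ 3 - uu1 q"
  "tsv q $ 4 = uu2 q - uu1 q"
  unfolding tsv_def vector_def by simp_all

lemma linear_coordinates:
  shows "linear (\<lambda>q::complex^6. q $ i)" "linear xplus" "linear uu1" "linear uu2" "linear uu3" "linear tsv"
proof -
  show x: "linear xplus"
    by (rule linearI) (simp_all add: xplus_def field_simps scaleR_conv_of_real[of _ "_ :: complex"])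
  show c: "linear (\<lambda>q::complex^6. q $ i)" for i
    by (rule linearI) simp_all
  show u1: "linear uu1" "linear uu2" "linear uu3"
    unfolding uu1_def uu2_def uu3_def uplus_def
    by (intro linear_compose_add linear_compose_sub x c)+
  show "linear tsv"
    by (rule linearI)
      (simp_all add: vec_eq_iff forall_4 tsv_nth linear_add[OF u1(1)] linear_add[OF u1(2)]
        linear_cmul[OF u1(1)] linear_cmul[OF u1(2)] algebra_simps)
qed

text \<open>The relations for the momenta are proved as products; this divides by \<open>rt2\<close>
  where the theorem allows it.\<close>

lemma quotient_momentum:
  fixes rt1 rt2 e d v y k w :: complex
  assumes "rt2 * e = rt1 * d" "v - y = k * (w + e)" "rt2 \<noteq> 0"
  shows "v = y + k * (w + rt1 / rt2 * d)"
proof -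
  have "e = rt1 / rt2 * d" using assms(1,3) by (simp add: field_simps)
  then show ?thesis using assms(2) by (simp add: algebra_simps)
qed

lemma ball_three: "(\<forall>j\<in>{1,2,3::nat}. P j) \<longleftrightarrow> P 1 \<and> P 2 \<and> P 3"
  by simp

lemma if_three:
  "(if (1::nat) = 1 then x else y) = x" "(if (2::nat) = 1 then x else y) = y" "(if (2::nat) = 2 then x else y) = x"
  "(if (3::nat) = 1 then x else y) = y" "(if (3::nat) = 2 then x else y) = y"
  by simp_all

lemma cancel_two: "x * (2 * y) = 2 * v * w \<Longrightarrow> x * y = v * w" for x y v w :: complex
proof -
  assume "x * (2 * y) = 2 * v * w"
  then have "2 * (x * y) = 2 * (v * w)" by algebra
  then show ?thesis by (simp only: mult_left_cancel[OF zero_neq_numeral[symmetric]])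
qed

text \<open>Only linear algebra: all zeta values are abstracted to coefficients. The last three
  claims give v_j - y_1, in which v_+ and the averages coming from u_+ drop out.\<close>

lemma generating_function_partials:
  fixes L Fb :: "complex^6 \<Rightarrow> complex" and g :: complex
  assumes L: "(L has_derivative (\<lambda>h. c1 * h$1 + c2 * h$2 + c3 * h$3 - d1 * uu1 h - d2 * uu2 h - d3 * uu3 h
     - e12 * (h$1 - h$2) - e13 * (h$1 - h$3) - e23 * (h$2 - h$3))) (at p)" (is "(L has_derivative ?DL) _")
    and Fb: "(Fb has_derivative (\<lambda>h. m1 * (h$1 - uu1 h) + m2 * (h$2 - uu1 h) + m3 * (h$3 - uu1 h)
       + k * (uu2 h - uu1 h))) (at p)" (is "(Fb has_derivative ?DF) _")
  defines "F \<equiv> \<lambda>q. q$6 * xplus q + g * L q + g * Fb q"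
  shows "cpartial Fb 1 p - cpartial Fb 3 p = m1 - m3" "cpartial Fb 2 p - cpartial Fb 3 p = m2 - m3"
    "((\<lambda>q. F q - q$6 * uplus q) has_derivative
       (\<lambda>h. cpartial F 1 p * h$1 + cpartial F 2 p * h$2 + cpartial F 3 p * h$3
          - p$6 * uplus h - - cpartial F 4 p * h$4 - - cpartial F 5 p * h$5)) (at p)"
    "(p$6 - - cpartial F 4 p - - cpartial F 5 p) / 3 + - cpartial F 4 p - cpartial F 1 p
       = g * (d1 - c1 + e12 + e13 + m2 + m3 + k)"
    "(p$6 - - cpartial F 4 p - - cpartial F 5 p) / 3 + - cpartial F 5 p - cpartial F 1 p
       = g * (d2 - c1 + e12 + e13 - k - m1)"
    "(p$6 - - cpartial F 4 p - - cpartial F 5 p) / 3 - cpartial F 1 p = g * (d3 - c1 + e12 + e13 - m1)"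
proof -
  \<comment> \<open>Each x_i enters every u_j with coefficient 1/3, which produces these
    averages.\<close>
  define d m where "d = (d1 + d2 + d3) / 3" and "m = (m1 + m2 + m3) / 3"
  define D where "D h = p$6 * xplus h + h$6 * xplus p + g * ?DL h + g * ?DF h" for h
  note lin = linear_coordinates[THEN linear_has_derivative, where p = p]
  note uus = xplus_def uu1_def uu2_def uu3_def uplus_def
  have F: "(F has_derivative D) (at p)"
    unfolding D_def[abs_def] F_def
    by (intro has_derivative_add has_derivative_mult has_derivative_mult_right lin L Fb)
  have hom: "xplus (w *s h) = w * xplus h" "uu1 (w *s h) = w * uu1 h" "uu2 (w *s h) = w * uu2 h"
    "uu3 (w *s h) = w * uu3 h" for w h
    by (simp_all add: uus field_simps)
  have cF: "cpartial F i p = D (axis i 1)" for i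
    by (rule cpartial_eq[OF F]) (simp add: D_def hom algebra_simps)
  have cFb: "cpartial Fb i p = ?DF (axis i 1)" for i
    by (rule cpartial_eq[OF Fb]) (simp add: hom algebra_simps)
  have ax: "(axis i (1::complex) :: complex^6) $ j = (if j = i then 1 else 0)" for i j
    by (simp add: axis_def)
  have y: "cpartial F 1 p = p$6 / 3 + g * (c1 - e12 - e13 - d + m1 - m)"
    "cpartial F 2 p = p$6 / 3 + g * (c2 + e12 - e23 - d + m2 - m)"
    "cpartial F 3 p = p$6 / 3 + g * (c3 + e13 + e23 - d + m3 - m)"
    "cpartial F 4 p = g * (d3 - d1 - 3 * m - k)"
    "cpartial F 5 p = g * (d3 - d2 + k)"
    unfolding cF D_def d_def m_def by (simp_all add: uus ax field_simps)
  show "cpartial Fb 1 p - cpartial Fb 3 p = m1 - m3" "cpartial Fb 2 p - cpartial Fb 3 p = m2 - m3"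
    unfolding cFb by (simp_all add: uus ax)
  show "(p$6 - - cpartial F 4 p - - cpartial F 5 p) / 3 + - cpartial F 4 p - cpartial F 1 p
       = g * (d1 - c1 + e12 + e13 + m2 + m3 + k)"
    "(p$6 - - cpartial F 4 p - - cpartial F 5 p) / 3 + - cpartial F 5 p - cpartial F 1 p
       = g * (d2 - c1 + e12 + e13 - k - m1)"
    "(p$6 - - cpartial F 4 p - - cpartial F 5 p) / 3 - cpartial F 1 p = g * (d3 - c1 + e12 + e13 - m1)"
    unfolding y d_def m_def by (simp_all add: field_simps)
  have "D h - (p$6 * uplus h + h$6 * uplus p) = cpartial F 1 p * h$1 + cpartial F 2 p * h$2 + cpartial F 3 p * h$3
      - p$6 * uplus h - - cpartial F 4 p * h$4 - - cpartial F 5 p * h$5" for h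
    unfolding y D_def d_def m_def by (simp add: uus field_simps)
  moreover have "((\<lambda>q. F q - q$6 * uplus q) has_derivative
      (\<lambda>h. D h - (p$6 * uplus h + h$6 * uplus p))) (at p)"
  proof -
    have uplus: "uplus = xplus" by (simp add: fun_eq_iff uplus_def)
    show ?thesis unfolding uplus by (intro has_derivative_diff has_derivative_mult F lin)
  qed
  ultimately show "((\<lambda>q. F q - q$6 * uplus q) has_derivative
       (\<lambda>h. cpartial F 1 p * h$1 + cpartial F 2 p * h$2 + cpartial F 3 p * h$3
          - p$6 * uplus h - - cpartial F 4 p * h$4 - - cpartial F 5 p * h$5)) (at p)"
    by (simp only:)
qed

context
  fixes w1 w2 :: complex
  assumes nonreal: "Im (w2 / w1) \<noteq> 0"
begin

section \<open>The period lattice\<close>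

abbreviation "\<Lambda> \<equiv> wlattice w1 w2"
abbreviation "\<zeta> \<equiv> wzeta w1 w2"
abbreviation "\<sigma> \<equiv> wsigma w1 w2"

lemma lattice_0 [simp]: "0 \<in> \<Lambda>"
  unfolding wlattice_def by (auto intro: exI[of _ 0])

lemma lattice_add: "v \<in> \<Lambda> \<Longrightarrow> w \<in> \<Lambda> \<Longrightarrow> v + w \<in> \<Lambda>"
  unfolding wlattice_def
proof clarify
  fix m n m' n' :: int
  show "\<exists>m'' n''. 2 * of_int m * w1 + 2 * of_int n * w2 + (2 * of_int m' * w1 + 2 * of_int n' * w2)
      = 2 * of_int m'' * w1 + 2 * of_int n'' * w2 \<and> True"
    by (rule exI[of _ "m + m'"], rule exI[of _ "n + n'"]) (simp add: algebra_simps)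
qed

lemma lattice_uminus: "w \<in> \<Lambda> \<Longrightarrow> - w \<in> \<Lambda>"
  unfolding wlattice_def
proof clarify
  fix m n :: int
  show "\<exists>m' n'. - (2 * of_int m * w1 + 2 * of_int n * w2) = 2 * of_int m' * w1 + 2 * of_int n' * w2 \<and> True"
    by (rule exI[of _ "-m"], rule exI[of _ "-n"]) simp
qed

lemma lattice_uminus_iff [simp]: "- w \<in> \<Lambda> \<longleftrightarrow> w \<in> \<Lambda>"
  using lattice_uminus[of w] lattice_uminus[of "- w"] by auto

lemma lattice_diff: "v \<in> \<Lambda> \<Longrightarrow> w \<in> \<Lambda> \<Longrightarrow> v - w \<in> \<Lambda>"
  using lattice_add[of v "- w"] by simp

lemma lattice_add_iff: "w \<in> \<Lambda> \<Longrightarrow> z + w \<in> \<Lambda> \<longleftrightarrow> z \<in> \<Lambda>"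
  using lattice_add[of z w] lattice_diff[of "z + w" w] by auto

lemma lattice_minus_commute: "a - b \<in> \<Lambda> \<longleftrightarrow> b - a \<in> \<Lambda>"
  using lattice_uminus_iff[of "a - b"] by simp

text \<open>Since \<tau> = w2 / w1 is not real, the imaginary part of x + y \<tau> controls y, and
  then the triangle inequality controls x. Discreteness of the lattice and convergence of its sums
  rest on this bound.\<close>

lemma coordinate_bound:
  obtains c where "c > 0" "\<And>x y :: real. \<bar>x\<bar> + \<bar>y\<bar> \<le> c * norm (2 * of_real x * w1 + 2 * of_real y * w2)"
proof -
  define \<tau> where "\<tau> = w2 / w1"
  have w1: "w1 \<noteq> 0" and im: "\<bar>Im \<tau>\<bar> > 0" using nonreal by (auto simp: \<tau>_def)
  define K where "K = 1 / \<bar>Im \<tau>\<bar> + (1 + norm \<tau> / \<bar>Im \<tau>\<bar>)"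
  have K: "K > 0" unfolding K_def using im by (intro add_pos_nonneg add_nonneg_nonneg) auto
  have bound: "\<bar>x\<bar> + \<bar>y\<bar> \<le> K * norm (of_real x + of_real y * \<tau>)" for x y :: real
  proof -
    let ?u = "of_real x + of_real y * \<tau>"
    have "\<bar>y\<bar> * \<bar>Im \<tau>\<bar> \<le> norm ?u"
      using abs_Im_le_cmod[of ?u] by (simp add: abs_mult)
    then have y: "\<bar>y\<bar> \<le> norm ?u / \<bar>Im \<tau>\<bar>" using im by (simp add: field_simps)
    have "\<bar>x\<bar> = norm (?u - of_real y * \<tau>)" by simp
    also have "\<dots> \<le> norm ?u + norm (of_real y * \<tau>)" by (rule norm_triangle_ineq4)
    also have "norm (of_real y * \<tau>) = \<bar>y\<bar> * norm \<tau>" by (simp add: norm_mult)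
    also have "\<bar>y\<bar> * norm \<tau> \<le> norm ?u / \<bar>Im \<tau>\<bar> * norm \<tau>" by (rule mult_right_mono[OF y]) simp
    finally show ?thesis using y by (simp add: K_def algebra_simps)
  qed
  show ?thesis
  proof (rule that[of "K / (2 * norm w1)"])
    show "K / (2 * norm w1) > 0" using K w1 by simp
    fix x y :: real
    have "2 * of_real x * w1 + 2 * of_real y * w2 = 2 * w1 * (of_real x + of_real y * \<tau>)"
      using w1 by (simp add: \<tau>_def field_simps)
    then show "\<bar>x\<bar> + \<bar>y\<bar> \<le> K / (2 * norm w1) * norm (2 * of_real x * w1 + 2 * of_real y * w2)"
      using bound[of x y] w1 by (simp add: norm_mult)
  qed
qed

lemma coordinates:
  obtains x y :: real where "z = 2 * of_real x * w1 + 2 * of_real y * w2"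
proof -
  define \<tau> where "\<tau> = w2 / w1"
  have w1: "w1 \<noteq> 0" and im: "Im \<tau> \<noteq> 0" using nonreal by (auto simp: \<tau>_def)
  define y where "y = Im (z / (2 * w1)) / Im \<tau>"
  define x where "x = Re (z / (2 * w1)) - y * Re \<tau>"
  have "z / (2 * w1) = of_real x + of_real y * \<tau>"
    using im by (simp add: complex_eq_iff x_def y_def)
  then have "z = 2 * w1 * (of_real x + of_real y * \<tau>)" using w1 by (simp add: field_simps)
  also have "\<dots> = 2 * of_real x * w1 + 2 * of_real y * w2"
    using w1 by (simp add: \<tau>_def field_simps)
  finally show ?thesis by (rule that)
qed

text \<open>Representatives in a bounded set make a periodic entire function bounded, as Liouville's
  theorem requires.\<close>

lemma reduce_mod_lattice:
  obtains p w where "z = p + w" "w \<in> \<Lambda>" "norm p \<le> 2 * norm w1 + 2 * norm w2"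
proof -
  obtain x y :: real where z: "z = 2 * of_real x * w1 + 2 * of_real y * w2" by (rule coordinates)
  define w where "w = 2 * of_int \<lfloor>x\<rfloor> * w1 + 2 * of_int \<lfloor>y\<rfloor> * w2"
  have "w \<in> \<Lambda>" unfolding w_def wlattice_def by blast
  have "z - w = of_real (frac x) * (2 * w1) + of_real (frac y) * (2 * w2)"
    by (simp add: z w_def frac_def algebra_simps)
  then have "norm (z - w) \<le> norm (of_real (frac x) * (2 * w1)) + norm (of_real (frac y) * (2 * w2))"
    by (metis norm_triangle_ineq)
  also have "\<dots> = frac x * (2 * norm w1) + frac y * (2 * norm w2)"
    by (simp add: norm_mult)
  also have "\<dots> \<le> 1 * (2 * norm w1) + 1 * (2 * norm w2)"
    by (intro add_mono mult_right_mono) (auto simp: frac_lt_1 less_imp_le)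
  finally show ?thesis using that[of "z - w" w] \<open>w \<in> \<Lambda>\<close> by simp
qed

lemma finite_lattice_norm_le: "finite {w \<in> \<Lambda>. norm w \<le> R}"
proof -
  obtain c where c: "c > 0" "\<And>x y :: real. \<bar>x\<bar> + \<bar>y\<bar> \<le> c * norm (2 * of_real x * w1 + 2 * of_real y * w2)"
    using coordinate_bound by blast
  define N where "N = \<lceil>c * R\<rceil>"
  have "{w \<in> \<Lambda>. norm w \<le> R} \<subseteq> (\<lambda>(m, n). 2 * of_int m * w1 + 2 * of_int n * w2) ` ({-N..N} \<times> {-N..N})"
  proof
    fix w assume "w \<in> {w \<in> \<Lambda>. norm w \<le> R}"
    then obtain m n where w: "w = 2 * of_int m * w1 + 2 * of_int n * w2" and "norm w \<le> R"
      unfolding wlattice_def by blast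
    have "\<bar>real_of_int m\<bar> + \<bar>real_of_int n\<bar> \<le> c * norm w" using c(2)[of m n] by (simp add: w)
    also have "\<dots> \<le> c * R" using \<open>norm w \<le> R\<close> c(1) by simp
    finally have "\<bar>m\<bar> \<le> N" "\<bar>n\<bar> \<le> N" unfolding N_def by linarith+
    then show "w \<in> (\<lambda>(m, n). 2 * of_int m * w1 + 2 * of_int n * w2) ` ({-N..N} \<times> {-N..N})"
      by (auto simp: w abs_le_iff intro!: image_eqI[of _ _ "(m, n)"])
  qed
  then show ?thesis by (rule finite_subset) auto
qed

text \<open>With s = |m| + |n| >= 1, the inequality (1 + |m|)(1 + |n|) <= (2 s)^2 splits the
  exponent 3 evenly and dominates the double series by a product of two convergent series with
  exponent 3/2.\<close>

lemma summable_lattice: "(\<lambda>w. 1 / norm w ^ 3) summable_on \<Lambda>"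
proof -
  obtain c where c: "c > 0" "\<And>x y :: real. \<bar>x\<bar> + \<bar>y\<bar> \<le> c * norm (2 * of_real x * w1 + 2 * of_real y * w2)"
    using coordinate_bound by blast
  let ?h = "\<lambda>m::int. (1 + \<bar>real_of_int m\<bar>) powr (-3/2)"
  let ?w = "\<lambda>(m, n). 2 * of_int m * w1 + 2 * of_int n * w2"
  have prod: "(\<lambda>(m, n). ?h m * ?h n) summable_on UNIV \<times> UNIV"
  proof (rule summable_on_SigmaI)
    show "((\<lambda>n. case (m, n) of (m, n) \<Rightarrow> ?h m * ?h n) has_sum (?h m * infsum ?h UNIV)) UNIV" for m
      using has_sum_cmult_right[OF has_sum_infsum[OF summable_on_int_powr]] by simp
    show "(\<lambda>m. ?h m * infsum ?h UNIV) summable_on UNIV"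
      using summable_on_cmult_left[OF summable_on_int_powr] by simp
  qed auto
  have "(\<lambda>p. 1 / norm (?w p) ^ 3) summable_on UNIV \<times> UNIV"
  proof (rule summable_on_comparison_test)
    show "(\<lambda>p. (8 * c ^ 3) * (case p of (m, n) \<Rightarrow> ?h m * ?h n)) summable_on UNIV \<times> UNIV"
      by (rule summable_on_cmult_right[OF prod])
    fix p :: "int \<times> int"
    obtain m n where p: "p = (m, n)" by (cases p)
    let ?m = "\<bar>real_of_int m\<bar>" and ?n = "\<bar>real_of_int n\<bar>"
    show "1 / norm (?w p) ^ 3 \<le> (8 * c ^ 3) * (case p of (m, n) \<Rightarrow> ?h m * ?h n)"
    proof (cases "m = 0 \<and> n = 0")
      \<comment> \<open>The term of the lattice point 0 is 1 / 0 = 0.\<close>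
      case True then show ?thesis using c(1) by (simp add: p)
    next
      case False
      define s where "s = ?m + ?n"
      have s1: "1 \<le> s" using False unfolding s_def by linarith
      have s: "s \<le> c * norm (?w p)" using c(2)[of m n] by (simp add: p s_def)
      have "(1 + ?m) * (1 + ?n) \<le> (2 * s) * (2 * s)"
        using s1 by (intro mult_mono) (auto simp: s_def)
      then have "(1 + ?m) * (1 + ?n) \<le> (2 * s) powr 2"
        using s1 by (simp add: power2_eq_square powr_numeral)
      then have "((2 * s) powr 2) powr (-3/2) \<le> ((1 + ?m) * (1 + ?n)) powr (-3/2)"
        by (intro powr_mono2') auto
      also have "\<dots> = ?h m * ?h n" by (simp add: powr_mult)
      also have "((2 * s) powr 2) powr (-3/2) = (2 * s) powr (-3)"
        by (simp add: powr_powr)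
      also have "\<dots> = 1 / (2 * s) ^ 3" using s1 by (simp add: powr_minus_divide powr_numeral)
      finally have h: "1 / (8 * s ^ 3) \<le> ?h m * ?h n" by (simp add: power_mult_distrib)
      have pos: "norm (?w p) > 0" 
        using less_le_trans[OF _ s, of 0] s1 c(1) by (simp add: zero_less_mult_iff)
      have "s ^ 3 \<le> (c * norm (?w p)) ^ 3" using s s1 by (intro power_mono) auto
      then have "1 / norm (?w p) ^ 3 \<le> c ^ 3 / s ^ 3"
        using pos s1 by (simp add: field_simps power_mult_distrib)
      also have "\<dots> = 8 * c ^ 3 * (1 / (8 * s ^ 3))" by simp
      also have "\<dots> \<le> 8 * c ^ 3 * (?h m * ?h n)" using h c(1) by (intro mult_left_mono) auto
      finally show ?thesis by (simp add: p)
    qed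
  qed auto
  moreover have "inj_on ?w (UNIV \<times> UNIV)"
  proof (rule inj_onI, clarify)
    fix m n m' n' :: int
    assume "2 * of_int m * w1 + 2 * of_int n * w2 = 2 * of_int m' * w1 + 2 * of_int n' * w2"
    then have "2 * of_real (real_of_int (m - m')) * w1 + 2 * of_real (real_of_int (n - n')) * w2 = 0"
      by (simp add: algebra_simps)
    then have "\<bar>real_of_int (m - m')\<bar> + \<bar>real_of_int (n - n')\<bar> \<le> 0"
      using c(2)[of "real_of_int (m - m')" "real_of_int (n - n')"] by simp
    then show "m = m' \<and> n = n'" by linarith
  qed
  moreover have "\<Lambda> = ?w ` (UNIV \<times> UNIV)" unfolding wlattice_def by auto
  ultimately show ?thesis by (simp add: summable_on_reindex o_def)
qed

lemma not_lattice_near: "\<forall>\<^sub>F z in at a. z \<notin> \<Lambda>"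
proof -
  define S where "S = {w \<in> \<Lambda>. norm w \<le> norm a + 1} - {a}"
  have "finite S" using finite_lattice_norm_le by (simp add: S_def)
  then have "open (- S)" "a \<in> - S" 
    by (simp_all only: finite_imp_closed open_Compl) (simp add: S_def)
  then have "\<forall>\<^sub>F z in at a. z \<notin> S"
    using eventually_at_in_open'[of "- S" a] by simp
  moreover have "\<forall>\<^sub>F z in at a. z \<in> ball a 1" by (rule eventually_at_in_open') auto
  moreover have "\<forall>\<^sub>F z in at a. z \<noteq> a" by (simp add: eventually_at_filter)
  ultimately show ?thesis
  proof eventually_elim
    case (elim z)
    have "norm z \<le> norm a + 1"
      using elim(2) norm_triangle_sub[of z a] by (simp add: dist_norm norm_minus_commute)
    with elim show ?case by (auto simp: S_def)
  qed
qed

lemma not_lattice_nhds: "a \<notin> \<Lambda> \<Longrightarrow> \<forall>\<^sub>F z in nhds a. z \<notin> \<Lambda>"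
  using not_lattice_near[of a] by (auto simp: eventually_at_filter elim: eventually_mono)

lemma closed_lattice: "closed \<Lambda>"
proof -
  have "\<exists>T. open T \<and> a \<in> T \<and> T \<subseteq> - \<Lambda>" if "a \<in> - \<Lambda>" for a
    using not_lattice_nhds[of a] that unfolding eventually_nhds by blast
  then have "open (- \<Lambda>)" by (subst open_subopen) blast
  then show ?thesis by (simp add: closed_def)
qed

section \<open>The zeta and sigma functions\<close>

text \<open>The correction terms leave exactly z^2 / (w^2 (z - w)), of cubic decay; the factor 2
  comes from |z - w| >= |w| / 2.\<close>

lemma zeta_term_bound:
  fixes z w :: complex
  assumes "norm z \<le> R" "R > 0" "2 * R \<le> norm w"
  shows "norm (1 / (z - w) + 1 / w + z / w\<^sup>2) \<le> 2 * R\<^sup>2 / norm w ^ 3"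
proof -
  have w: "norm w > 0" using assms by linarith
  have half: "norm w / 2 \<le> norm (z - w)"
    using norm_triangle_ineq3[of w z] assms by (simp add: norm_minus_commute)
  then have "z \<noteq> w" "w \<noteq> 0" using w by auto
  have "1 / d + 1 / w + (w + d) / w\<^sup>2 = (w + d)\<^sup>2 / (w\<^sup>2 * d)" if "d \<noteq> 0" "w \<noteq> 0" for d
    using that by (simp add: field_simps power2_eq_square)
  from this[of "z - w"] \<open>z \<noteq> w\<close> \<open>w \<noteq> 0\<close>
  have "1 / (z - w) + 1 / w + z / w\<^sup>2 = z\<^sup>2 / (w\<^sup>2 * (z - w))" by simp
  then have "norm (1 / (z - w) + 1 / w + z / w\<^sup>2) = (norm z)\<^sup>2 / ((norm w)\<^sup>2 * norm (z - w))"
    by (simp add: norm_divide norm_mult norm_power)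
  also have "\<dots> \<le> R\<^sup>2 / ((norm w)\<^sup>2 * (norm w / 2))"
    using assms half w by (intro frac_le mult_left_mono power_mono mult_pos_pos) auto
  also have "\<dots> = 2 * R\<^sup>2 / norm w ^ 3" by (simp add: power2_eq_square power3_eq_cube)
  finally show ?thesis .
qed

lemma log_term_deriv:
  assumes "norm z < norm w"
  shows "((\<lambda>z. Ln (1 - z / w) + z / w + z\<^sup>2 / (2 * w\<^sup>2)) has_field_derivative
           1 / (z - w) + 1 / w + z / w\<^sup>2) (at z)"
proof -
  have w: "w \<noteq> 0" "z \<noteq> w" using assms by auto
  have "norm (z / w) < 1" using assms w by (simp add: norm_divide)
  then have "Re (1 - z / w) > 0" using complex_Re_le_cmod[of "z / w"] by simp
  then have "1 - z / w \<notin> \<real>\<^sub>\<le>\<^sub>0" by (auto simp: complex_nonpos_Reals_iff)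
  then show ?thesis using w
    by (auto intro!: derivative_eq_intros simp: divide_simps) (auto simp: algebra_simps power2_eq_square)
qed

text \<open>The term vanishes at z = 0, so the bound on its derivative integrates over the disc and
  contributes one more factor \<open>R\<close>.\<close>

lemma log_term_bound:
  assumes "norm z \<le> R" "R > 0" "2 * R \<le> norm w"
  shows "norm (Ln (1 - z / w) + z / w + z\<^sup>2 / (2 * w\<^sup>2)) \<le> 2 * R ^ 3 / norm w ^ 3"
proof -
  let ?l = "\<lambda>z. Ln (1 - z / w) + z / w + z\<^sup>2 / (2 * w\<^sup>2)"
  have "norm (?l z - ?l 0) \<le> 2 * R\<^sup>2 / norm w ^ 3 * norm (z - 0)"
  proof (rule field_differentiable_bound)
    show "convex (cball 0 R :: complex set)" by simp
    show "(?l has_field_derivative 1 / (x - w) + 1 / w + x / w\<^sup>2) (at x within cball 0 R)"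
      if "x \<in> cball 0 R" for x
      by (rule has_field_derivative_at_within, rule log_term_deriv) (use that assms in simp)
    show "norm (1 / (x - w) + 1 / w + x / w\<^sup>2) \<le> 2 * R\<^sup>2 / norm w ^ 3"
      if "x \<in> cball 0 R" for x
      by (rule zeta_term_bound) (use that assms in simp_all)
  qed (use assms in auto)
  also have "\<dots> \<le> 2 * R\<^sup>2 / norm w ^ 3 * R" using assms by (intro mult_left_mono) auto
  finally show ?thesis by (simp add: power2_eq_square power3_eq_cube mult.assoc)
qed

lemma far_summable:
  "(\<lambda>w. c / norm w ^ 3 :: real) summable_on {w \<in> \<Lambda>. 2 * R \<le> norm w}"
  using summable_on_cmult_right[OF summable_on_subset[OF summable_lattice], of _ c] by simp

lemma finite_near: "finite {w \<in> \<Lambda> - {0}. norm w < 2 * R}"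
  by (rule finite_subset[OF _ finite_lattice_norm_le[of "2 * R"]]) auto

lemma split_lattice: "\<Lambda> - {0} = {w \<in> \<Lambda> - {0}. norm w < 2 * R} \<union> {w \<in> \<Lambda>. 2 * R \<le> norm w}"
  if "R > 0" using that by auto

text \<open>Only the far part of the sum of logarithms is differentiated termwise: the principal branch
  of the logarithm jumps along rays for the finitely many near lattice points, whose factors are
  therefore kept as a product below.\<close>
lemma log_tail_deriv:
  assumes R: "R > 0" and z: "z \<in> ball 0 R"
  defines "S \<equiv> {w \<in> \<Lambda>. 2 * R \<le> norm w}"
  shows "((\<lambda>z. \<Sum>\<^sub>\<infinity>w\<in>S. Ln (1 - z / w) + z / w + z\<^sup>2 / (2 * w\<^sup>2)) has_field_derivative
          (\<Sum>\<^sub>\<infinity>w\<in>S. 1 / (z - w) + 1 / w + z / w\<^sup>2)) (at z)"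
proof -
  let ?l = "\<lambda>w z. Ln (1 - z / w) + z / w + z\<^sup>2 / (2 * w\<^sup>2)"
  let ?t = "\<lambda>w z. 1 / (z - w) + 1 / w + z / w\<^sup>2"
  have lim: "uniform_limit (cball 0 R) (\<lambda>X z. \<Sum>w\<in>X. ?l w z) (\<lambda>z. \<Sum>\<^sub>\<infinity>w\<in>S. ?l w z) (finite_subsets_at_top S)"
    by (rule Weierstrass_m_test_general[of _ _ _ "\<lambda>w. 2 * R ^ 3 / norm w ^ 3"])
      (use R far_summable in \<open>auto simp: S_def intro: log_term_bound\<close>)
  have deriv: "((\<lambda>z. \<Sum>w\<in>X. ?l w z) has_field_derivative (\<Sum>w\<in>X. ?t w x)) (at x)"
    if "finite X" "X \<subseteq> S" "x \<in> cball 0 R" for X x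
    using that R by (intro DERIV_sum log_term_deriv) (auto simp: S_def)
  have "\<forall>\<^sub>F X in finite_subsets_at_top S. continuous_on (cball 0 R) (\<lambda>z. \<Sum>w\<in>X. ?l w z) \<and>
      (\<forall>x\<in>ball 0 R. ((\<lambda>z. \<Sum>w\<in>X. ?l w z) has_field_derivative (\<Sum>w\<in>X. ?t w x)) (at x))"
    by (rule eventually_finite_subsets_at_top_weakI)
      (intro conjI ballI continuous_at_imp_continuous_on DERIV_isCont[OF deriv] deriv; auto)
  \<comment> \<open>Uniform convergence of the logarithms also gives convergence of the derivatives,
    so the zeta series needs no uniform estimate of its own here.\<close>
  then obtain g' where g': "\<And>x. x \<in> ball 0 R \<Longrightarrow>
      ((\<lambda>z. \<Sum>\<^sub>\<infinity>w\<in>S. ?l w z) has_field_derivative g' x) (at x) \<and>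
      ((\<lambda>X. \<Sum>w\<in>X. ?t w x) \<longlongrightarrow> g' x) (finite_subsets_at_top S)"
    by (rule has_complex_derivative_uniform_limit[OF _ lim]) (use R in auto)
  then have "((\<lambda>w. ?t w z) has_sum g' z) S" using z by (simp add: has_sum_def)
  then show ?thesis using g'[OF z] by (simp add: infsumI)
qed

text \<open>The sum may include 0: its term is 1 / z, because the two corrections divide by zero and
  so vanish.\<close>

lemma zeta_terms_summable: "(\<lambda>w. 1 / (z - w) + 1 / w + z / w\<^sup>2) summable_on \<Lambda>"
proof -
  define R where "R = norm z + 1"
  have R: "R > 0" "norm z \<le> R" by (simp_all add: R_def add_nonneg_pos)
  have "(\<lambda>w. 1 / (z - w) + 1 / w + z / w\<^sup>2) summable_on {w \<in> \<Lambda>. 2 * R \<le> norm w}"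
    by (rule abs_summable_summable, rule Infinite_Sum.abs_summable_on_comparison_test'[OF far_summable[of "2 * R\<^sup>2"]])
      (rule zeta_term_bound[OF R(2,1)], simp)
  then have "(\<lambda>w. 1 / (z - w) + 1 / w + z / w\<^sup>2) summable_on
      ({w \<in> \<Lambda> - {0}. norm w < 2 * R} \<union> {w \<in> \<Lambda>. 2 * R \<le> norm w})"
    by (rule summable_on_union[OF summable_on_finite[OF finite_near]])
  then have "(\<lambda>w. 1 / (z - w) + 1 / w + z / w\<^sup>2) summable_on (insert 0 (\<Lambda> - {0}))"
    using split_lattice[OF R(1)] by (simp only: summable_on_insert_iff)
  then show ?thesis by (simp add: insert_absorb)
qed

lemma log_terms_summable: "(\<lambda>w. Ln (1 - z / w) + z / w + z\<^sup>2 / (2 * w\<^sup>2)) summable_on {w \<in> \<Lambda>. 2 * R \<le> norm w}"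
  if "norm z \<le> R" "R > 0"
  by (rule abs_summable_summable, rule Infinite_Sum.abs_summable_on_comparison_test'[OF far_summable[of "2 * R ^ 3"]])
    (rule log_term_bound[OF that], simp)

lemma zeta_split:
  assumes "R > 0"
  shows "\<zeta> z = 1 / z + (\<Sum>w \<in> {w \<in> \<Lambda> - {0}. norm w < 2 * R}. 1 / (z - w) + 1 / w + z / w\<^sup>2)
     + (\<Sum>\<^sub>\<infinity>w\<in>{w \<in> \<Lambda>. 2 * R \<le> norm w}. 1 / (z - w) + 1 / w + z / w\<^sup>2)"
proof -
  let ?t = "\<lambda>w. 1 / (z - w) + 1 / w + z / w\<^sup>2"
  have "infsum ?t (\<Lambda> - {0}) = infsum ?t ({w \<in> \<Lambda> - {0}. norm w < 2 * R} \<union> {w \<in> \<Lambda>. 2 * R \<le> norm w})"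
    by (rule arg_cong[OF split_lattice[OF assms]])
  also have "\<dots> = infsum ?t {w \<in> \<Lambda> - {0}. norm w < 2 * R} + infsum ?t {w \<in> \<Lambda>. 2 * R \<le> norm w}"
    by (rule infsum_Un_disjoint) (auto intro!: summable_on_subset[OF zeta_terms_summable])
  finally show ?thesis unfolding wzeta_def infsum_finite[OF finite_near] by (simp only: add.assoc)
qed

text \<open>Exponentiating turns the near logarithms into factors without branch cuts, so the jumps
  of \<open>Ln\<close> in the definition of sigma disappear.\<close>

lemma sigma_split:
  assumes "norm z \<le> R" "R > 0" "z \<notin> \<Lambda>"
  shows "\<sigma> z = z * (\<Prod>w \<in> {w \<in> \<Lambda> - {0}. norm w < 2 * R}. (1 - z / w) * exp (z / w + z\<^sup>2 / (2 * w\<^sup>2)))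
     * exp (\<Sum>\<^sub>\<infinity>w\<in>{w \<in> \<Lambda>. 2 * R \<le> norm w}. Ln (1 - z / w) + z / w + z\<^sup>2 / (2 * w\<^sup>2))"
proof -
  let ?l = "\<lambda>w. Ln (1 - z / w) + z / w + z\<^sup>2 / (2 * w\<^sup>2)"
  have "infsum ?l (\<Lambda> - {0}) = infsum ?l ({w \<in> \<Lambda> - {0}. norm w < 2 * R} \<union> {w \<in> \<Lambda>. 2 * R \<le> norm w})"
    by (rule arg_cong[OF split_lattice[OF assms(2)]])
  also have "\<dots> = infsum ?l {w \<in> \<Lambda> - {0}. norm w < 2 * R} + infsum ?l {w \<in> \<Lambda>. 2 * R \<le> norm w}"
    by (rule infsum_Un_disjoint[OF summable_on_finite[OF finite_near] log_terms_summable[OF assms(1,2)]]) auto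
  finally have "infsum ?l (\<Lambda> - {0}) = infsum ?l {w \<in> \<Lambda> - {0}. norm w < 2 * R} + infsum ?l {w \<in> \<Lambda>. 2 * R \<le> norm w}" .
  moreover have "exp (\<Sum>w \<in> {w \<in> \<Lambda> - {0}. norm w < 2 * R}. ?l w)
      = (\<Prod>w \<in> {w \<in> \<Lambda> - {0}. norm w < 2 * R}. (1 - z / w) * exp (z / w + z\<^sup>2 / (2 * w\<^sup>2)))"
    unfolding exp_sum[OF finite_near]
  proof (rule prod.cong[OF refl])
    fix w assume "w \<in> {w \<in> \<Lambda> - {0}. norm w < 2 * R}"
    then have "1 - z / w \<noteq> 0" using assms(3) by auto
    then have "exp (Ln (1 - z / w)) = 1 - z / w" by (rule exp_Ln)
    then show "exp (?l w) = (1 - z / w) * exp (z / w + z\<^sup>2 / (2 * w\<^sup>2))"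
      by (simp only: add.assoc exp_add[of "Ln (1 - z / w)"])
  qed
  ultimately show ?thesis
    using assms(3) unfolding wsigma_def infsum_finite[OF finite_near] by (simp only: if_False exp_add mult.assoc)
qed

lemma sigma_eq_0_iff: "\<sigma> z = 0 \<longleftrightarrow> z \<in> \<Lambda>"
  using lattice_0 unfolding wsigma_def by auto

lemma sigma_deriv:
  assumes z: "z \<notin> \<Lambda>"
  shows "(\<sigma> has_field_derivative \<sigma> z * \<zeta> z) (at z)"
proof -
  define R where "R = norm z + 1"
  have R: "R > 0" "z \<in> ball 0 R" by (simp_all add: R_def add_nonneg_pos)
  define S where "S = {w \<in> \<Lambda> - {0}. norm w < 2 * R}"
  define T where "T = {w \<in> \<Lambda>. 2 * R \<le> norm w}"
  let ?f = "\<lambda>w z. (1 - z / w) * exp (z / w + z\<^sup>2 / (2 * w\<^sup>2))"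
  let ?t = "\<lambda>w. 1 / (z - w) + 1 / w + z / w\<^sup>2"
  let ?L = "\<lambda>z. \<Sum>\<^sub>\<infinity>w\<in>T. Ln (1 - z / w) + z / w + z\<^sup>2 / (2 * w\<^sup>2)"
  have "finite S" unfolding S_def by (rule finite_near)
  have "z \<noteq> 0" using z by auto
  have "(?f w has_field_derivative ?f w z * ?t w) (at z)" if "w \<in> S" for w
  proof -
    have "w \<noteq> 0" "z \<noteq> w" using that z by (auto simp: S_def)
    then have "z - w \<noteq> 0" by simp
    have D: "(?f w has_field_derivative (- 1 / w) * exp (z / w + z\<^sup>2 / (2 * w\<^sup>2)) +
            exp (z / w + z\<^sup>2 / (2 * w\<^sup>2)) * (1 / w + z / w\<^sup>2) * (1 - z / w)) (at z)"
      by (rule derivative_eq_intros refl | use \<open>w \<noteq> 0\<close> in \<open>simp add: field_simps power2_eq_square\<close>)+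
    have w: "- 1 / w = (1 - z / w) * (1 / (z - w))"
      using \<open>w \<noteq> 0\<close> \<open>z - w \<noteq> 0\<close> by (simp add: field_simps)
    have factor: "a * q * e + e * (c + d) * a = a * e * (q + c + d)" for a q e c d :: complex
      by (simp add: algebra_simps)
    show ?thesis by (rule D[unfolded w factor])
  qed
  from has_field_derivative_prod_log[OF \<open>finite S\<close> this]
  have "((\<lambda>z. z * (\<Prod>w\<in>S. ?f w z) * exp (?L z)) has_field_derivative
      (1 * (\<Prod>w\<in>S. ?f w z) + (\<Prod>w\<in>S. ?f w z) * (\<Sum>w\<in>S. ?t w) * z) * exp (?L z)
        + exp (?L z) * (\<Sum>\<^sub>\<infinity>w\<in>T. ?t w) * (z * (\<Prod>w\<in>S. ?f w z))) (at z)"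
    unfolding T_def by (intro DERIV_mult DERIV_ident DERIV_fun_exp log_tail_deriv R)
  also have "(1 * (\<Prod>w\<in>S. ?f w z) + (\<Prod>w\<in>S. ?f w z) * (\<Sum>w\<in>S. ?t w) * z) * exp (?L z)
        + exp (?L z) * (\<Sum>\<^sub>\<infinity>w\<in>T. ?t w) * (z * (\<Prod>w\<in>S. ?f w z))
      = z * (\<Prod>w\<in>S. ?f w z) * exp (?L z) * (1 / z + (\<Sum>w\<in>S. ?t w) + (\<Sum>\<^sub>\<infinity>w\<in>T. ?t w))"
    using \<open>z \<noteq> 0\<close> by (simp add: field_simps)
  also have "1 / z + (\<Sum>w\<in>S. ?t w) + (\<Sum>\<^sub>\<infinity>w\<in>T. ?t w) = \<zeta> z"
    unfolding S_def T_def by (rule zeta_split[OF R(1), symmetric])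
  also have "z * (\<Prod>w\<in>S. ?f w z) * exp (?L z) = \<sigma> z"
    unfolding S_def T_def by (rule sigma_split[symmetric]) (use R z in auto)
  finally have D: "((\<lambda>z. z * (\<Prod>w\<in>S. ?f w z) * exp (?L z)) has_field_derivative \<sigma> z * \<zeta> z) (at z)" .
  show ?thesis
  proof (rule has_field_derivative_transform_within_open[OF D])
    show "open (ball 0 R - \<Lambda>)" by (intro open_Diff open_ball closed_lattice)
    show "x * (\<Prod>w\<in>S. ?f w x) * exp (?L x) = \<sigma> x" if "x \<in> ball 0 R - \<Lambda>" for x
      unfolding S_def T_def by (rule sigma_split[symmetric]) (use R that in auto)
  qed (use R z in auto)
qed

section \<open>Oddness, principal part and quasi-periods of zeta\<close>

lemma zeta_uminus [simp]: "\<zeta> (- z) = - \<zeta> z"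
proof -
  let ?t = "\<lambda>z w. 1 / (z - w) + 1 / w + z / w\<^sup>2"
  have "bij_betw uminus (\<Lambda> - {0}) (\<Lambda> - {0})"
    by (rule bij_betwI[of _ _ _ uminus]) auto
  then have "infsum (?t (- z)) (\<Lambda> - {0}) = (\<Sum>\<^sub>\<infinity>w\<in>\<Lambda> - {0}. ?t (- z) (- w))"
    by (rule infsum_reindex_bij_betw[symmetric])
  also have "(\<lambda>w. ?t (- z) (- w)) = (\<lambda>w. - ?t z w)"
  proof
    fix w
    have "1 / (- z - - w) = - (1 / (z - w))"
      using minus_divide_right[of 1 "z - w"] by simp
    then show "?t (- z) (- w) = - ?t z w" by simp
  qed
  finally have t: "infsum (?t (- z)) (\<Lambda> - {0}) = - infsum (?t z) (\<Lambda> - {0})"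
    unfolding infsum_uminus .
  show ?thesis unfolding wzeta_def t by simp
qed

lemma zeta_minus_commute: "\<zeta> (a - b) = - \<zeta> (b - a)"
  using zeta_uminus[of "b - a"] unfolding minus_diff_eq .

text \<open>The tail is the derivative of the tail of the logarithmic sum, which is itself
  holomorphic.\<close>

lemma zeta_tail_holomorphic:
  assumes "R > 0"
  shows "(\<lambda>z. \<Sum>\<^sub>\<infinity>w\<in>{w \<in> \<Lambda>. 2 * R \<le> norm w}. 1 / (z - w) + 1 / w + z / w\<^sup>2) holomorphic_on ball 0 R"
proof -
  define l where "l = (\<lambda>z. \<Sum>\<^sub>\<infinity>w\<in>{w \<in> \<Lambda>. 2 * R \<le> norm w}. Ln (1 - z / w) + z / w + z\<^sup>2 / (2 * w\<^sup>2))"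
  define t where "t = (\<lambda>z. \<Sum>\<^sub>\<infinity>w\<in>{w \<in> \<Lambda>. 2 * R \<le> norm w}. 1 / (z - w) + 1 / w + z / w\<^sup>2)"
  have l: "(l has_field_derivative t z) (at z)" if "z \<in> ball 0 R" for z
    unfolding l_def t_def by (rule log_tail_deriv[OF assms that])
  then have "l holomorphic_on ball 0 R"
    unfolding holomorphic_on_open[OF open_ball] by blast
  then have "deriv l holomorphic_on ball 0 R" by (rule holomorphic_deriv) simp
  then have "t holomorphic_on ball 0 R"
    by (rule holomorphic_transform) (rule DERIV_imp_deriv[OF l])
  then show ?thesis unfolding t_def .
qed

lemma zeta_local:
  assumes "R > 0"
  obtains t where "t holomorphic_on ball 0 R"
    "\<And>z. \<zeta> z = 1 / z + ((\<Sum>w \<in> {w \<in> \<Lambda> - {0}. norm w < 2 * R}. 1 / (z - w) + 1 / w + z / w\<^sup>2) + t z)"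
proof (rule that)
  show "(\<lambda>z. \<Sum>\<^sub>\<infinity>w\<in>{w \<in> \<Lambda>. 2 * R \<le> norm w}. 1 / (z - w) + 1 / w + z / w\<^sup>2) holomorphic_on ball 0 R"
    by (rule zeta_tail_holomorphic[OF assms])
qed (simp only: zeta_split[OF assms] add.assoc)

lemma zeta_holomorphic: "\<zeta> holomorphic_on - \<Lambda>"
proof -
  have "\<zeta> field_differentiable at z" if "z \<notin> \<Lambda>" for z
  proof -
    define R where "R = norm z + 1"
    have R: "R > 0" "z \<in> ball 0 R - \<Lambda>" using that by (simp_all add: R_def add_nonneg_pos)
    obtain t where t: "t holomorphic_on ball 0 R" and eq:
      "\<And>z. \<zeta> z = 1 / z + ((\<Sum>w \<in> {w \<in> \<Lambda> - {0}. norm w < 2 * R}. 1 / (z - w) + 1 / w + z / w\<^sup>2) + t z)"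
      using zeta_local[OF R(1)] by blast
    have t': "t holomorphic_on ball 0 R - \<Lambda>" by (rule holomorphic_on_subset[OF t]) auto
    have "(\<lambda>z. 1 / z + ((\<Sum>w \<in> {w \<in> \<Lambda> - {0}. norm w < 2 * R}. 1 / (z - w) + 1 / w + z / w\<^sup>2) + t z))
        holomorphic_on ball 0 R - \<Lambda>"
      by (intro holomorphic_on_add holomorphic_on_sum holomorphic_on_divide holomorphic_on_diff
           holomorphic_on_ident holomorphic_on_const t') auto
    then have "\<zeta> holomorphic_on ball 0 R - \<Lambda>"
      by (rule holomorphic_transform) (simp only: eq)
    then show ?thesis using R
      by (meson closed_lattice holomorphic_on_imp_differentiable_at open_Diff open_ball)
  qed
  then show ?thesis
    by (simp add: field_differentiable_at_within holomorphic_on_def)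
qed

lemma zeta_deriv: "z \<notin> \<Lambda> \<Longrightarrow> (\<zeta> has_field_derivative deriv \<zeta> z) (at z)"
  using zeta_holomorphic closed_lattice holomorphic_derivI[of \<zeta> "- \<Lambda>" z] by (simp add: open_Compl)

lemma zeta_principal_part:
  "\<exists>r>0. \<exists>h. h holomorphic_on ball 0 r \<and> (\<forall>z. \<zeta> z = 1 / z + h z) \<and> h 0 = 0"
proof -
  define S where "S = {w \<in> \<Lambda> - {0}. norm w < 2 * 1}"
  have "finite S" unfolding S_def by (rule finite_near)
  then have "open (- S)" "0 \<in> - S" by (simp_all add: finite_imp_closed open_Compl S_def)
  then obtain e where e: "e > 0" "ball 0 e \<subseteq> - S" by (meson open_contains_ball)
  define r where "r = min e 1"
  obtain t where t: "t holomorphic_on ball 0 1" and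
    zeta: "\<And>z. \<zeta> z = 1 / z + ((\<Sum>w\<in>S. 1 / (z - w) + 1 / w + z / w\<^sup>2) + t z)"
    using zeta_local[OF zero_less_one] unfolding S_def by blast
  have t': "t holomorphic_on ball 0 r" by (rule holomorphic_on_subset[OF t]) (auto simp: r_def)
  define h where "h z = (\<Sum>w\<in>S. 1 / (z - w) + 1 / w + z / w\<^sup>2) + t z" for z
  have eq: "\<zeta> z = 1 / z + h z" for z
    unfolding h_def by (rule zeta)
  show ?thesis
  proof (intro exI[of _ r] exI[of _ h] conjI allI)
    show "r > 0" using e by (simp add: r_def)
    show "h holomorphic_on ball 0 r"
      unfolding h_def
    proof (intro holomorphic_on_add holomorphic_on_sum holomorphic_on_divide holomorphic_on_diff
           holomorphic_on_ident holomorphic_on_const t')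
      show "x - w \<noteq> 0" if "w \<in> S" "x \<in> ball 0 r" for x w
        using that e(2) by (auto simp: r_def subset_iff)
      show "w\<^sup>2 \<noteq> 0" "w \<noteq> 0" if "w \<in> S" for w using that by (simp_all add: S_def)
    qed
    \<comment> \<open>As 1 / 0 = 0, the decomposition at 0 reads \<open>\<zeta> 0 = h 0\<close>, and
      oddness makes it vanish.\<close>
    have "\<zeta> 0 = - \<zeta> 0" using zeta_uminus[of 0] by simp
    then show "h 0 = 0" using eq[of 0] by simp
  qed (rule eq)
qed

text \<open>The difference $\zeta(z + w) - \zeta(z)$ is affine in $z$ by rearranging the series, and
  oddness makes it invariant under $z \mapsto - z - w$, so its slope vanishes.\<close>
lemma zeta_quasi_period:
  assumes w: "w \<in> \<Lambda>"
  shows "\<zeta> (a + w) - \<zeta> a = \<zeta> (b + w) - \<zeta> b"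
proof -
  let ?t = "\<lambda>z v. 1 / (z - v) + 1 / v + z / v\<^sup>2"
  define \<psi> where "\<psi> z = \<zeta> (z + w) - \<zeta> z" for z
  \<comment> \<open>The term at v = 0 is the leading 1 / z, so zeta is a sum over the whole lattice,
    which translation by \<open>w\<close> permutes.\<close>
  have zeta: "(?t z has_sum \<zeta> z) \<Lambda>" for z
  proof -
    have "((\<lambda>v. ?t z v) has_sum (?t z 0 + infsum (?t z) (\<Lambda> - {0}))) (insert 0 (\<Lambda> - {0}))"
      by (rule has_sum_insert) (auto intro: has_sum_infsum summable_on_subset[OF zeta_terms_summable])
    then show ?thesis by (simp add: wzeta_def insert_absorb)
  qed
  have bij: "bij_betw (\<lambda>v. v + w) \<Lambda> \<Lambda>"
    by (rule bij_betwI[of _ _ _ "\<lambda>v. v - w"]) (use w lattice_add lattice_diff in auto)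
  have \<psi>: "((\<lambda>v. ?t (z + w) (v + w) + - ?t z v) has_sum \<psi> z) \<Lambda>" for z
  proof -
    have "((\<lambda>v. ?t (z + w) (v + w)) has_sum \<zeta> (z + w)) \<Lambda>"
      using has_sum_reindex_bij_betw[OF bij, of "?t (z + w)"] zeta[of "z + w"] by simp
    from has_sum_add[OF this has_sum_uminusI[OF zeta[of z]]] show ?thesis
      unfolding \<psi>_def by (simp only: add_uminus_conv_diff)
  qed
  define C where "C = (\<Sum>\<^sub>\<infinity>v\<in>\<Lambda>. 1 / (v + w)\<^sup>2 - 1 / v\<^sup>2)"
  have lin: "\<psi> x - \<psi> y = (x - y) * C" for x y
  proof -
    have "((\<lambda>v. (?t (x + w) (v + w) + - ?t x v) + - (?t (y + w) (v + w) + - ?t y v))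
        has_sum (\<psi> x + - \<psi> y)) \<Lambda>"
      by (rule has_sum_add[OF \<psi> has_sum_uminusI[OF \<psi>]])
    also have "(\<lambda>v. (?t (x + w) (v + w) + - ?t x v) + - (?t (y + w) (v + w) + - ?t y v))
        = (\<lambda>v. (x - y) * (1 / (v + w)\<^sup>2 - 1 / v\<^sup>2))"
      by (simp add: fun_eq_iff algebra_simps diff_divide_distrib add_divide_distrib)
    finally have "infsum (\<lambda>v. (x - y) * (1 / (v + w)\<^sup>2 - 1 / v\<^sup>2)) \<Lambda> = \<psi> x + - \<psi> y"
      by (rule infsumI)
    then show ?thesis by (simp add: C_def infsum_cmult_right')
  qed
  have "\<psi> (- z - w) = \<psi> z" for z
  proof -
    have "\<psi> (- z - w) = \<zeta> (- z) - \<zeta> (- (z + w))"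
      unfolding \<psi>_def by (rule arg_cong2[of _ _ _ _ "\<lambda>a b. \<zeta> a - \<zeta> b"]) simp_all
    then show ?thesis unfolding \<psi>_def zeta_uminus by simp
  qed
  \<comment> \<open>This z is chosen so that - z - w and z differ by exactly 1.\<close>
  from this[of "(1 - w) / 2"] lin[of "- ((1 - w) / 2) - w" "(1 - w) / 2"]
  have "C = 0" by (simp add: field_simps)
  then show ?thesis using lin[of a b] by (simp add: \<psi>_def)
qed

section \<open>The addition law\<close>

lemma not_lattice_near_shift: "\<forall>\<^sub>F z in at a. z - s \<notin> \<Lambda>"
proof -
  obtain d where "d > 0" "\<And>x. x \<noteq> a - s \<Longrightarrow> dist x (a - s) < d \<Longrightarrow> x \<notin> \<Lambda>"
    using not_lattice_near[of "a - s"] unfolding eventually_at by auto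
  then show ?thesis unfolding eventually_at
    by (intro exI[of _ d]) (auto simp: dist_norm)
qed

text \<open>All singularities are removable, so \<open>f\<close> extends to an entire function;
  periodicity bounds it by its values on a disc, and Liouville applies. The second conclusion allows
  the constant to be evaluated at a removed point.\<close>

lemma elliptic_constant:
  assumes S: "finite S"
    and holo: "f holomorphic_on {z. \<forall>s\<in>S. z - s \<notin> \<Lambda>}"
    and per: "\<And>z w. \<forall>s\<in>S. z - s \<notin> \<Lambda> \<Longrightarrow> w \<in> \<Lambda> \<Longrightarrow> f (z + w) = f z"
    and lim: "\<And>s. s \<in> S \<Longrightarrow> \<exists>c. f \<midarrow>s\<rightarrow> c"
  obtains k where "\<And>z. \<forall>s\<in>S. z - s \<notin> \<Lambda> \<Longrightarrow> f z = k" "\<And>s. s \<in> S \<Longrightarrow> f \<midarrow>s\<rightarrow> k"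
proof -
  define U where "U = {z. \<forall>s\<in>S. z - s \<notin> \<Lambda>}"
  have near: "\<forall>\<^sub>F z in at a. z \<in> U" for a
    unfolding U_def using S not_lattice_near_shift by (simp add: eventually_ball_finite_distrib)
  have nhds: "\<forall>\<^sub>F z in nhds a. z \<in> U" if "a \<in> U" for a
    using near[of a] that by (auto simp: eventually_at_filter elim: eventually_mono)
  have "\<exists>T. open T \<and> a \<in> T \<and> T \<subseteq> U" if "a \<in> U" for a
    using nhds[OF that] unfolding eventually_nhds by blast
  then have "open U" by (subst open_subopen) blast
  \<comment> \<open>Limits are assumed at one representative of each coset; periodicity carries them
    to the others.\<close>
  have shift: "f \<midarrow>a + w\<rightarrow> c" if "f \<midarrow>a\<rightarrow> c" "w \<in> \<Lambda>" for a w c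
  proof -
    have "\<forall>\<^sub>F z in at a. f z = f (z + w)"
      using near by (rule eventually_mono) (use per that in \<open>auto simp: U_def\<close>)
    with that(1) have "(\<lambda>z. f (z + w)) \<midarrow>a\<rightarrow> c" by (rule Lim_transform_eventually)
    from LIM_offset[OF this, of "- w"] show ?thesis by (simp add: algebra_simps)
  qed
  have lim': "\<exists>c. f \<midarrow>a\<rightarrow> c" for a
  proof (cases "a \<in> U")
    case True
    then have "isCont f a"
      using holomorphic_on_imp_isCont[OF holo[folded U_def] \<open>open U\<close>] by simp
    then show ?thesis by (auto simp: isCont_def)
  next
    case False
    then obtain s where "s \<in> S" "a - s \<in> \<Lambda>" by (auto simp: U_def)
    then show ?thesis using lim[of s] shift[where a = s and w = "a - s"] by auto
  qed
  have iso: "isolated_singularity_at f a" for a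
  proof -
    obtain r where "r > 0" and r: "\<And>x. x \<noteq> a \<Longrightarrow> dist x a < r \<Longrightarrow> x \<in> U"
      using near[of a] unfolding eventually_at by auto
    have "ball a r - {a} \<subseteq> U"
    proof
      fix x assume "x \<in> ball a r - {a}"
      then show "x \<in> U" by (intro r) (auto simp: dist_commute)
    qed
    then have "f holomorphic_on ball a r - {a}"
      using holo holomorphic_on_subset unfolding U_def by blast
    then have "f analytic_on ball a r - {a}"
      by (subst analytic_on_open) (simp_all add: open_delete)
    then show ?thesis
      unfolding isolated_singularity_at_def using \<open>r > 0\<close> by blast
  qed
  define R where "R = remove_sings f"
  have R: "f \<midarrow>a\<rightarrow> R a" for a
    using lim'[of a] remove_sings_eqI unfolding R_def by blast
  have "R analytic_on {a}" for a
    unfolding R_def by (rule remove_sings_analytic_at[OF iso]) (use R in \<open>simp add: R_def\<close>)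
  then have entire: "R holomorphic_on UNIV"
    using analytic_on_analytic_at analytic_imp_holomorphic by blast
  have perR: "R (a + w) = R a" if "w \<in> \<Lambda>" for a w
    using LIM_unique[OF R shift[OF R that]] .
  have "range R \<subseteq> R ` cball 0 (2 * norm w1 + 2 * norm w2)"
  proof
    fix y assume "y \<in> range R"
    then obtain z where y: "y = R z" by blast
    obtain p w where "z = p + w" "w \<in> \<Lambda>" "norm p \<le> 2 * norm w1 + 2 * norm w2"
      by (rule reduce_mod_lattice)
    then show "y \<in> R ` cball 0 (2 * norm w1 + 2 * norm w2)"
      unfolding y by (intro image_eqI[of _ _ p]) (auto simp: perR)
  qed
  moreover have "bounded (R ` cball 0 (2 * norm w1 + 2 * norm w2))"
    by (intro compact_imp_bounded compact_continuous_image holomorphic_on_imp_continuous_on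
         holomorphic_on_subset[OF entire]) auto
  ultimately have "bounded (range R)" by (rule bounded_subset[rotated])
  then obtain k where k: "\<And>z. R z = k"
    using Liouville_theorem[OF entire] by (auto simp: constant_on_def)
  show ?thesis
  proof (rule that)
    show "f \<midarrow>s\<rightarrow> k" for s using R[of s] by (simp add: k)
    show "f z = k" if "\<forall>s\<in>S. z - s \<notin> \<Lambda>" for z
    proof -
      have "z \<in> U" using that by (simp add: U_def)
      then have "isCont f z"
        using holomorphic_on_imp_isCont[OF holo[folded U_def] \<open>open U\<close>] by simp
      then have "f \<midarrow>z\<rightarrow> f z" by (simp add: isCont_def)
      from LIM_unique[OF this R] show ?thesis by (simp add: k)
    qed
  qed
qed

lemma zeta_deriv_add_lattice:
  assumes "z \<notin> \<Lambda>" "w \<in> \<Lambda>"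
  shows "deriv \<zeta> (z + w) = deriv \<zeta> z"
proof -
  have "(\<zeta> has_field_derivative deriv \<zeta> (z + w)) (at (z + w))"
    by (rule zeta_deriv) (use assms in \<open>simp add: lattice_add_iff\<close>)
  then have shifted: "((\<lambda>x. \<zeta> (x + w)) has_field_derivative deriv \<zeta> (z + w)) (at z)"
    unfolding DERIV_shift .
  have "((\<lambda>x. \<zeta> (z + w) - \<zeta> z + \<zeta> x) has_field_derivative 0 + deriv \<zeta> z) (at z)"
    by (intro DERIV_add DERIV_const zeta_deriv assms)
  moreover have "(\<lambda>x. \<zeta> (z + w) - \<zeta> z + \<zeta> x) = (\<lambda>x. \<zeta> (x + w))"
    using zeta_quasi_period[OF assms(2), of z] by (auto simp: fun_eq_iff algebra_simps)
  ultimately show ?thesis using DERIV_unique[OF shifted] by simp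
qed

lemma zeta_residue: "(\<lambda>z. z * \<zeta> z) \<midarrow>0\<rightarrow> 1"
proof -
  obtain h r where hr: "r > 0" "h holomorphic_on ball 0 r" "\<forall>z. \<zeta> z = 1 / z + h z" "h 0 = 0"
    using zeta_principal_part by blast
  have "isCont h 0"
    using holomorphic_on_imp_isCont[OF hr(2) open_ball] hr(1) by simp
  then have "(\<lambda>z. 1 + z * h z) \<midarrow>0\<rightarrow> 1 + 0 * h 0" unfolding isCont_def by (intro tendsto_intros)
  moreover have "\<forall>\<^sub>F z in at 0. z \<in> ball 0 r - {0}"
    using hr(1) by (intro eventually_at_in_open) auto
  then have "\<forall>\<^sub>F z in at 0. 1 + z * h z = z * \<zeta> z"
    by (rule eventually_mono) (use hr(3) in \<open>auto simp: field_simps\<close>)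
  ultimately show ?thesis
    by (rule Lim_transform_eventually[THEN tendsto_eq_rhs]) simp
qed

text \<open>The addition law is Liouville's theorem in \<open>b\<close>. At \<open>- a\<close> the simple pole is cancelled by a
  zero of the other factor; at \<open>- c\<close> the same happens by symmetry, and at \<open>0\<close> the double poles
  cancel.\<close>
lemma zeta_pole_limit:
  assumes T: "T = \<zeta> a - \<zeta> c - \<zeta> (a - c)"
    and "a \<notin> \<Lambda>" "c \<notin> \<Lambda>" "a - c \<notin> \<Lambda>"
  shows "\<exists>l. (\<lambda>b. (\<zeta> a + \<zeta> b - \<zeta> (a + b)) * (\<zeta> b + \<zeta> c - \<zeta> (b + c))
      - T * ((\<zeta> b + \<zeta> c - \<zeta> (b + c)) - (\<zeta> a + \<zeta> b - \<zeta> (a + b))) + deriv \<zeta> b) \<midarrow>- a\<rightarrow> l"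
proof -
  have nl: "- a \<notin> \<Lambda>" "- a + c \<notin> \<Lambda>"
    using assms lattice_minus_commute[of a c] by (auto simp: algebra_simps)
  let ?F = "\<lambda>b. \<zeta> a + \<zeta> b - \<zeta> (a + b)" and ?H = "\<lambda>b. \<zeta> b + \<zeta> c - \<zeta> (b + c)"
  have zc: "((\<lambda>b. \<zeta> (b + c)) has_field_derivative deriv \<zeta> (- a + c)) (at (- a))"
    using zeta_deriv[OF nl(2)] unfolding DERIV_shift .
  define d where "d = deriv \<zeta> (- a) - deriv \<zeta> (- a + c)"
  have H: "(?H has_field_derivative d) (at (- a))"
    unfolding d_def by (auto intro!: derivative_eq_intros zeta_deriv[OF nl(1)] zc)
  have "(\<lambda>b. (\<zeta> a + \<zeta> b) * (b + a) - (b + a) * \<zeta> (b + a)) \<midarrow>- a\<rightarrow> (\<zeta> a + \<zeta> (- a)) * (- a + a) - 1"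
  proof (intro tendsto_intros)
    show "\<zeta> \<midarrow>- a\<rightarrow> \<zeta> (- a)" using DERIV_isCont[OF zeta_deriv[OF nl(1)]] by (simp add: isCont_def)
    show "(\<lambda>b. (b + a) * \<zeta> (b + a)) \<midarrow>- a\<rightarrow> 1" using LIM_offset[OF zeta_residue, of a] by simp
  qed
  then have F: "(\<lambda>b. (b - - a) * ?F b) \<midarrow>- a\<rightarrow> - 1" by (simp add: algebra_simps)
  have "((\<lambda>b. ?H b + T) has_field_derivative d) (at (- a))"
    using DERIV_add[OF H DERIV_const[of T]] by simp
  \<comment> \<open>This is what determines \<open>T\<close>: the expression equals F (H + T) - T H
    plus a regular term, and H + T must vanish at the pole of F.\<close>
  moreover have "?H (- a) + T = 0"
    using zeta_minus_commute[of a c] by (simp add: T add.commute[of "- a" c])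
  ultimately have FH: "(\<lambda>b. ?F b * (?H b + T)) \<midarrow>- a\<rightarrow> - 1 * d"
    by (rule tendsto_pole_times_zero[OF F])
  have Hl: "?H \<midarrow>- a\<rightarrow> ?H (- a)" using DERIV_isCont[OF H] by (simp add: isCont_def)
  have dl: "deriv \<zeta> \<midarrow>- a\<rightarrow> deriv \<zeta> (- a)"
  proof -
    have "deriv \<zeta> holomorphic_on - \<Lambda>"
      by (rule holomorphic_deriv[OF zeta_holomorphic]) (simp add: closed_lattice open_Compl)
    then have "isCont (deriv \<zeta>) (- a)"
      by (rule holomorphic_on_imp_isCont) (use nl closed_lattice in \<open>simp_all add: open_Compl\<close>)
    then show ?thesis by (simp add: isCont_def)
  qed
  have "(\<lambda>b. ?F b * (?H b + T) - T * ?H b + deriv \<zeta> b) \<midarrow>- a\<rightarrow>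
      - 1 * d - T * ?H (- a) + deriv \<zeta> (- a)"
    by (rule tendsto_add[OF tendsto_diff[OF FH tendsto_mult[OF tendsto_const Hl]] dl])
  moreover have "(\<lambda>b. ?F b * (?H b + T) - T * ?H b + deriv \<zeta> b) =
      (\<lambda>b. ?F b * ?H b - T * (?H b - ?F b) + deriv \<zeta> b)"
    by (simp add: fun_eq_iff algebra_simps)
  ultimately show ?thesis by auto
qed

text \<open>F and H both behave as 1 / b, so F H cancels the -1 / b^2 of the derivative, while H - F
  tends to 0 and removes \<open>T\<close>. The constant \<open>k\<close> is fixed before
  \<open>a\<close> and \<open>c\<close>, since one function must serve all instances of the addition
  law.\<close>

lemma zeta_double_pole_limit:
  obtains k where "\<And>a c T. a \<notin> \<Lambda> \<Longrightarrow> c \<notin> \<Lambda> \<Longrightarrow>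
    (\<lambda>b. (\<zeta> a + \<zeta> b - \<zeta> (a + b)) * (\<zeta> b + \<zeta> c - \<zeta> (b + c))
      - T * ((\<zeta> b + \<zeta> c - \<zeta> (b + c)) - (\<zeta> a + \<zeta> b - \<zeta> (a + b))) + deriv \<zeta> b) \<midarrow>0\<rightarrow>
      3 * k - deriv \<zeta> a - deriv \<zeta> c"
proof -
  obtain h r where hr: "r > 0" "h holomorphic_on ball 0 r" "\<forall>z. \<zeta> z = 1 / z + h z" "h 0 = 0"
    using zeta_principal_part by blast
  have h: "(h has_field_derivative deriv h z) (at z)" if "z \<in> ball 0 r" for z
    using holomorphic_derivI[OF hr(2) open_ball that] .
  have h': "deriv h \<midarrow>0\<rightarrow> deriv h 0"
  proof -
    have "deriv h holomorphic_on ball 0 r" by (rule holomorphic_deriv[OF hr(2)]) simp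
    then have "isCont (deriv h) 0" using hr(1) holomorphic_on_imp_isCont[OF _ open_ball] by simp
    then show ?thesis by (simp add: isCont_def)
  qed
  have dzeta: "deriv \<zeta> z = - 1 / z\<^sup>2 + deriv h z" if "z \<in> ball 0 r - {0}" for z
  proof -
    have "((\<lambda>z. 1 / z + h z) has_field_derivative - 1 / z\<^sup>2 + deriv h z) (at z)"
      using that by (auto intro!: derivative_eq_intros h simp: power2_eq_square)
    then have "(\<zeta> has_field_derivative - 1 / z\<^sup>2 + deriv h z) (at z)"
      by (rule has_field_derivative_transform_within_open[of _ _ _ "ball 0 r"]) (use that hr in auto)
    then show ?thesis by (rule DERIV_imp_deriv)
  qed
  show ?thesis
  proof (rule that)
    fix a c T assume "a \<notin> \<Lambda>" "c \<notin> \<Lambda>"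
    define \<phi> where "\<phi> e b = h b + \<zeta> e - \<zeta> (b + e)" for e b
    have \<phi>: "(\<phi> e has_field_derivative deriv h 0 - deriv \<zeta> e) (at 0)" if "e \<notin> \<Lambda>" for e
    proof -
      have "((\<lambda>b. \<zeta> (b + e)) has_field_derivative deriv \<zeta> e) (at 0)"
        using zeta_deriv[OF that] DERIV_shift[of \<zeta> _ 0 e] by simp
      then show ?thesis unfolding \<phi>_def
        by (auto intro!: derivative_eq_intros h hr(1))
    qed
    have \<phi>0: "\<phi> e 0 = 0" for e by (simp add: \<phi>_def hr(4))
    have inv: "(\<lambda>z::complex. (z - 0) * (1 / z)) \<midarrow>0\<rightarrow> 1"
      by (rule Lim_transform_eventually[OF tendsto_const]) (auto simp: eventually_at_filter)
    have q: "(\<lambda>b. 1 / b * \<phi> e b) \<midarrow>0\<rightarrow> 1 * (deriv h 0 - deriv \<zeta> e)" if "e \<notin> \<Lambda>" for e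
      by (rule tendsto_pole_times_zero[OF inv \<phi>[OF that] \<phi>0])
    have c: "\<phi> e \<midarrow>0\<rightarrow> 0" if "e \<notin> \<Lambda>" for e
      using DERIV_isCont[OF \<phi>[OF that]] by (simp add: isCont_def \<phi>0)
    have "(\<lambda>b. 1 / b * \<phi> a b + 1 / b * \<phi> c b + \<phi> a b * \<phi> c b - T * (\<phi> c b - \<phi> a b) + deriv h b) \<midarrow>0\<rightarrow>
        1 * (deriv h 0 - deriv \<zeta> a) + 1 * (deriv h 0 - deriv \<zeta> c) + 0 * 0 - T * (0 - 0) + deriv h 0"
      by (intro tendsto_add tendsto_diff tendsto_mult tendsto_const q c h' \<open>a \<notin> \<Lambda>\<close> \<open>c \<notin> \<Lambda>\<close>)
    moreover have "\<forall>\<^sub>F b in at 0. b \<in> ball 0 r - {0}"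
      using hr(1) by (intro eventually_at_in_open) auto
    then have "\<forall>\<^sub>F b in at 0. 1 / b * \<phi> a b + 1 / b * \<phi> c b + \<phi> a b * \<phi> c b - T * (\<phi> c b - \<phi> a b) + deriv h b
      = (\<zeta> a + \<zeta> b - \<zeta> (a + b)) * (\<zeta> b + \<zeta> c - \<zeta> (b + c))
      - T * ((\<zeta> b + \<zeta> c - \<zeta> (b + c)) - (\<zeta> a + \<zeta> b - \<zeta> (a + b))) + deriv \<zeta> b"
    proof (rule eventually_mono)
      fix b :: complex assume b: "b \<in> ball 0 r - {0}"
      have F: "\<zeta> a + \<zeta> b - \<zeta> (a + b) = 1 / b + \<phi> a b" "\<zeta> b + \<zeta> c - \<zeta> (b + c) = 1 / b + \<phi> c b"
        using spec[OF hr(3), of b] by (simp_all add: \<phi>_def add.commute)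
      have "1 / b * (1 / b) = 1 / b\<^sup>2" by (simp add: power2_eq_square)
      then show "1 / b * \<phi> a b + 1 / b * \<phi> c b + \<phi> a b * \<phi> c b - T * (\<phi> c b - \<phi> a b) + deriv h b
        = (\<zeta> a + \<zeta> b - \<zeta> (a + b)) * (\<zeta> b + \<zeta> c - \<zeta> (b + c))
        - T * ((\<zeta> b + \<zeta> c - \<zeta> (b + c)) - (\<zeta> a + \<zeta> b - \<zeta> (a + b))) + deriv \<zeta> b"
        unfolding F dzeta[OF b] by (simp add: algebra_simps)
    qed
    ultimately show "(\<lambda>b. (\<zeta> a + \<zeta> b - \<zeta> (a + b)) * (\<zeta> b + \<zeta> c - \<zeta> (b + c))
      - T * ((\<zeta> b + \<zeta> c - \<zeta> (b + c)) - (\<zeta> a + \<zeta> b - \<zeta> (a + b))) + deriv \<zeta> b) \<midarrow>0\<rightarrow>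
      3 * deriv h 0 - deriv \<zeta> a - deriv \<zeta> c"
      by (rule Lim_transform_eventually[THEN tendsto_eq_rhs]) simp
  qed
qed

text \<open>The function \<open>p\<close> is the Weierstrass function $\wp$ up to an additive constant, which cancels in
  all applications. Being free of denominators, the law also covers coincidences such as
  \<open>b = c\<close>.\<close>
definition addition_law :: "(complex \<Rightarrow> complex) \<Rightarrow> bool" where
  "addition_law p \<longleftrightarrow> (\<forall>a b c. a \<notin> \<Lambda> \<longrightarrow> b \<notin> \<Lambda> \<longrightarrow> c \<notin> \<Lambda> \<longrightarrow> a + b \<notin> \<Lambda> \<longrightarrow> b + c \<notin> \<Lambda> \<longrightarrow> a - c \<notin> \<Lambda> \<longrightarrow>
     (\<zeta> a + \<zeta> b - \<zeta> (a + b)) * (\<zeta> b + \<zeta> c - \<zeta> (b + c))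
     - (\<zeta> a - \<zeta> c - \<zeta> (a - c)) * ((\<zeta> b + \<zeta> c - \<zeta> (b + c)) - (\<zeta> a + \<zeta> b - \<zeta> (a + b)))
     = p a + p b + p c)"

lemma zeta_shift_holomorphic:
  assumes "\<And>z. z \<in> U \<Longrightarrow> e + z \<notin> \<Lambda>"
  shows "(\<lambda>z. \<zeta> (e + z)) holomorphic_on U"
proof -
  have "\<zeta> \<circ> (\<lambda>z. e + z) holomorphic_on U"
    by (rule holomorphic_on_compose_gen[OF _ zeta_holomorphic]) (use assms in \<open>auto intro!: holomorphic_intros\<close>)
  then show ?thesis by (simp add: o_def)
qed

lemma addition_law_exists: "\<exists>p. addition_law p"
proof -
  obtain k where k: "\<And>a c T. a \<notin> \<Lambda> \<Longrightarrow> c \<notin> \<Lambda> \<Longrightarrow>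
    (\<lambda>b. (\<zeta> a + \<zeta> b - \<zeta> (a + b)) * (\<zeta> b + \<zeta> c - \<zeta> (b + c))
      - T * ((\<zeta> b + \<zeta> c - \<zeta> (b + c)) - (\<zeta> a + \<zeta> b - \<zeta> (a + b))) + deriv \<zeta> b) \<midarrow>0\<rightarrow>
      3 * k - deriv \<zeta> a - deriv \<zeta> c"
    by (rule zeta_double_pole_limit) blast
  have "addition_law (\<lambda>z. k - deriv \<zeta> z)"
    unfolding addition_law_def
  proof (intro allI impI)
    fix a b c
    assume nl: "a \<notin> \<Lambda>" "b \<notin> \<Lambda>" "c \<notin> \<Lambda>" "a + b \<notin> \<Lambda>" "b + c \<notin> \<Lambda>" "a - c \<notin> \<Lambda>"
    define T where "T = \<zeta> a - \<zeta> c - \<zeta> (a - c)"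
    define f where "f = (\<lambda>b. (\<zeta> a + \<zeta> b - \<zeta> (a + b)) * (\<zeta> b + \<zeta> c - \<zeta> (b + c))
      - T * ((\<zeta> b + \<zeta> c - \<zeta> (b + c)) - (\<zeta> a + \<zeta> b - \<zeta> (a + b))) + deriv \<zeta> b)"
    define S where "S = {0, - a, - c}"
    let ?U = "{z. \<forall>s\<in>S. z - s \<notin> \<Lambda>}"
    have U: "?U = {z. z \<notin> \<Lambda> \<and> a + z \<notin> \<Lambda> \<and> c + z \<notin> \<Lambda>}" by (auto simp: S_def add.commute)
    have f0: "f \<midarrow>0\<rightarrow> 3 * k - deriv \<zeta> a - deriv \<zeta> c" unfolding f_def by (rule k[OF nl(1,3)])
    have fa: "\<exists>l. f \<midarrow>- a\<rightarrow> l" unfolding f_def by (rule zeta_pole_limit[OF T_def nl(1,3,6)])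
    have fc: "\<exists>l. f \<midarrow>- c\<rightarrow> l"
    proof -
      have "- T = \<zeta> c - \<zeta> a - \<zeta> (c - a)"
        using zeta_minus_commute[of c a] by (simp add: T_def)
      moreover have "c - a \<notin> \<Lambda>" using nl(6) lattice_minus_commute[of a c] by simp
      ultimately have "\<exists>l. (\<lambda>b. (\<zeta> c + \<zeta> b - \<zeta> (c + b)) * (\<zeta> b + \<zeta> a - \<zeta> (b + a))
        - - T * ((\<zeta> b + \<zeta> a - \<zeta> (b + a)) - (\<zeta> c + \<zeta> b - \<zeta> (c + b))) + deriv \<zeta> b) \<midarrow>- c\<rightarrow> l"
        using zeta_pole_limit nl(1,3) by blast
      moreover have "(\<lambda>b. (\<zeta> c + \<zeta> b - \<zeta> (c + b)) * (\<zeta> b + \<zeta> a - \<zeta> (b + a))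
        - - T * ((\<zeta> b + \<zeta> a - \<zeta> (b + a)) - (\<zeta> c + \<zeta> b - \<zeta> (c + b))) + deriv \<zeta> b) = f"
        unfolding f_def by (simp add: fun_eq_iff algebra_simps)
      ultimately show ?thesis by simp
    qed
    have zeta_hol: "\<zeta> holomorphic_on ?U"
      by (rule holomorphic_on_subset[OF zeta_holomorphic]) (auto simp: U)
    have deriv_hol: "deriv \<zeta> holomorphic_on ?U"
    proof (rule holomorphic_on_subset)
      show "deriv \<zeta> holomorphic_on - \<Lambda>"
        by (rule holomorphic_deriv[OF zeta_holomorphic]) (simp add: closed_lattice open_Compl)
    qed (auto simp: U)
    have shift_hol: "(\<lambda>z. \<zeta> (a + z)) holomorphic_on ?U" "(\<lambda>z. \<zeta> (z + c)) holomorphic_on ?U"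
      unfolding add.commute[of _ c] by (rule zeta_shift_holomorphic; simp add: U)+
    obtain l where l: "\<And>z. \<forall>s\<in>S. z - s \<notin> \<Lambda> \<Longrightarrow> f z = l" "\<And>s. s \<in> S \<Longrightarrow> f \<midarrow>s\<rightarrow> l"
    proof (rule elliptic_constant[of S f])
      show "finite S" by (simp add: S_def)
      show "f holomorphic_on ?U" unfolding f_def
        by (intro holomorphic_on_add holomorphic_on_diff holomorphic_on_mult holomorphic_on_const
            zeta_hol deriv_hol shift_hol)
      show "f (z + w) = f z" if "\<forall>s\<in>S. z - s \<notin> \<Lambda>" "w \<in> \<Lambda>" for z w
      proof -
        have "z \<notin> \<Lambda>" using that(1) by (simp add: S_def)
        \<comment> \<open>The same increment occurs with opposite signs in each factor and
          cancels.\<close>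
        define \<eta> where "\<eta> = \<zeta> (z + w) - \<zeta> z"
        have "\<zeta> (z + w) = \<zeta> z + \<eta>" "\<zeta> (a + (z + w)) = \<zeta> (a + z) + \<eta>" "\<zeta> (z + w + c) = \<zeta> (z + c) + \<eta>"
          using zeta_quasi_period[OF that(2), of "a + z" z] zeta_quasi_period[OF that(2), of "z + c" z]
          by (simp_all add: \<eta>_def algebra_simps)
        then show ?thesis
          unfolding f_def zeta_deriv_add_lattice[OF \<open>z \<notin> \<Lambda>\<close> that(2)] by (simp add: algebra_simps)
      qed
      show "\<exists>c. f \<midarrow>s\<rightarrow> c" if "s \<in> S" for s using that f0 fa fc by (auto simp: S_def)
    qed blast
    \<comment> \<open>The constant in \<open>b\<close> is read off at the double pole 0; moving
      \<open>deriv \<zeta> b\<close> across gives the symmetric right-hand side.\<close>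
    have "l = 3 * k - deriv \<zeta> a - deriv \<zeta> c"
      using LIM_unique[OF l(2) f0] by (simp add: S_def)
    moreover have "f b = l" by (rule l(1)) (use nl in \<open>auto simp: S_def add.commute\<close>)
    ultimately have "f b = 3 * k - deriv \<zeta> a - deriv \<zeta> c" by simp
    then show "(\<zeta> a + \<zeta> b - \<zeta> (a + b)) * (\<zeta> b + \<zeta> c - \<zeta> (b + c))
     - (\<zeta> a - \<zeta> c - \<zeta> (a - c)) * ((\<zeta> b + \<zeta> c - \<zeta> (b + c)) - (\<zeta> a + \<zeta> b - \<zeta> (a + b)))
     = (k - deriv \<zeta> a) + (k - deriv \<zeta> b) + (k - deriv \<zeta> c)"
      unfolding f_def T_def by (simp add: algebra_simps)
  qed
  then show ?thesis by blast
qed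

text \<open>Sums and differences are separate variables with defining equations, so that instances
  match simplified arguments such as x - c for (x - a) + (- b).\<close>

lemma addition_lawD:
  assumes "addition_law p" "a \<notin> \<Lambda>" "b \<notin> \<Lambda>" "c \<notin> \<Lambda>" "d \<notin> \<Lambda>" "e \<notin> \<Lambda>" "f \<notin> \<Lambda>"
    and "d = a + b" "e = b + c" "f = a - c"
  shows "(\<zeta> a + \<zeta> b - \<zeta> d) * (\<zeta> b + \<zeta> c - \<zeta> e)
     - (\<zeta> a - \<zeta> c - \<zeta> f) * ((\<zeta> b + \<zeta> c - \<zeta> e) - (\<zeta> a + \<zeta> b - \<zeta> d))
     = p a + p b + p c"
  using assms unfolding addition_law_def by blast

section \<open>The separation relations\<close>

text \<open>In terms of \<open>T\<close> the coefficients in \<open>frakB\<close> are 2 T12, T13 -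
  T12 and - (T12 + T23), so both claims reduce to \<open>separation_algebra\<close>.\<close>

lemma separation_conclusion:
  fixes r1 r2 x1 x2 x3 u \<rho>1 \<rho>2 \<rho>3 K :: complex
  defines "T \<equiv> \<lambda>x y. \<zeta> (x - u) - \<zeta> (y - u) - \<zeta> (x - y)"
  assumes "2 * T x1 x2 * (\<rho>1 - \<rho>2) = \<rho>1\<^sup>2 + \<rho>2\<^sup>2 - \<rho>1 * \<rho>2 + K"
    and "2 * T x1 x3 * (\<rho>1 - \<rho>3) = \<rho>1\<^sup>2 + \<rho>3\<^sup>2 - \<rho>1 * \<rho>3 + K"
    and "2 * T x2 x3 * (\<rho>2 - \<rho>3) = \<rho>2\<^sup>2 + \<rho>3\<^sup>2 - \<rho>2 * \<rho>3 + K"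
    and r1: "r1 + 2 * (\<zeta> (x3 - u) - \<zeta> (x1 - u)) = \<rho>3 - \<rho>1"
    and r2: "r2 + 2 * (\<zeta> (x3 - u) - \<zeta> (x2 - u)) = \<rho>3 - \<rho>2"
  shows "frakB w1 w2 r1 r2 x1 x2 x3 u = 0"
    and "(r2 + 2 * \<zeta> (u - x2) - 2 * \<zeta> (u - x3)) * (\<rho>1 - \<rho>2 - \<rho>3 - 2 * T x1 x2)
       = 2 * (r1 + 2 * \<zeta> (u - x1) - 2 * \<zeta> (u - x3)) * (\<zeta> (u - x3) - \<zeta> (u - x2) + \<zeta> (x1 - x2) - \<zeta> (x1 - x3))"
proof -
  note alg = separation_algebra[OF assms(2-4)]
  have "frakB w1 w2 r1 r2 x1 x2 x3 u = (\<rho>3 - \<rho>1) * (\<rho>3 - \<rho>2) * ((\<rho>3 - \<rho>1) - (\<rho>3 - \<rho>2))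
      + 2 * (\<rho>3 - \<rho>1) * (\<rho>3 - \<rho>2) * T x1 x2
      + (\<rho>3 - \<rho>1)\<^sup>2 * (T x1 x3 - T x1 x2) + (\<rho>3 - \<rho>2)\<^sup>2 * (- (T x1 x2 + T x2 x3))"
    unfolding frakB_def Let_def r1 r2 T_def by (simp add: algebra_simps)
  also have "\<dots> = 0" using alg(1) by (simp add: algebra_simps)
  finally show "frakB w1 w2 r1 r2 x1 x2 x3 u = 0" .
  have "r1 + 2 * \<zeta> (u - x1) - 2 * \<zeta> (u - x3) = \<rho>3 - \<rho>1"
    "r2 + 2 * \<zeta> (u - x2) - 2 * \<zeta> (u - x3) = \<rho>3 - \<rho>2"
    using r1 r2 zeta_minus_commute[of u x1] zeta_minus_commute[of u x2] zeta_minus_commute[of u x3]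
    by (simp_all add: algebra_simps)
  moreover have "\<zeta> (u - x3) - \<zeta> (u - x2) + \<zeta> (x1 - x2) - \<zeta> (x1 - x3) = T x1 x3 - T x1 x2"
    unfolding T_def zeta_minus_commute[of u x2] zeta_minus_commute[of u x3] by simp
  ultimately show "(r2 + 2 * \<zeta> (u - x2) - 2 * \<zeta> (u - x3)) * (\<rho>1 - \<rho>2 - \<rho>3 - 2 * T x1 x2)
       = 2 * (r1 + 2 * \<zeta> (u - x1) - 2 * \<zeta> (u - x3)) * (\<zeta> (u - x3) - \<zeta> (u - x2) + \<zeta> (x1 - x2) - \<zeta> (x1 - x3))"
    using alg(2) by simp
qed

text \<open>\<open>A x\<close> is the slope expression of x - a and a, and \<open>M x\<close> that
  of x - a and - b, whose sum is x - c. Instances with middle argument a and - b share the same T12;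
  one with middle argument x - a gives the product of \<open>A x\<close> and \<open>M x\<close>.
  Since M x - A x = zeta(x) + zeta(c - x) - zeta(c) - l, the last hypothesis is
  stationarity.\<close>

lemma relation_first:
  fixes a1 a2 a3 a b c :: complex
  defines "l \<equiv> \<zeta> a + \<zeta> b - \<zeta> c"
  defines "A \<equiv> \<lambda>x. \<zeta> (x - a) + \<zeta> a - \<zeta> x"
  defines "M \<equiv> \<lambda>x. \<zeta> (x - a) - \<zeta> b + \<zeta> (c - x)"
  assumes p: "addition_law p" and c: "c = a + b"
    and nl: "a \<notin> \<Lambda>" "b \<notin> \<Lambda>" "c \<notin> \<Lambda>" "a1 \<notin> \<Lambda>" "a2 \<notin> \<Lambda>" "c - a1 \<notin> \<Lambda>" "c - a2 \<notin> \<Lambda>"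
      "a1 - a \<notin> \<Lambda>" "a2 - a \<notin> \<Lambda>" "a1 - a2 \<notin> \<Lambda>"
    and stat: "4 * l + (M a1 - A a1) + (M a2 - A a2) + (M a3 - A a3) = 0"
  shows "2 * (\<zeta> (a1 - a) - \<zeta> (a2 - a) - \<zeta> (a1 - a2)) * ((A a1 + M a1) - (A a2 + M a2)) =
    (A a1 + M a1)\<^sup>2 + (A a2 + M a2)\<^sup>2 - (A a1 + M a1) * (A a2 + M a2)
      + ((M a1 - A a1) * (M a2 - A a2) + (M a1 - A a1) * (M a3 - A a3) + (M a2 - A a2) * (M a3 - A a3)
         - 6 * (p a + p (- b)))"
proof (rule relation_first_algebra)
  have nl': "- b \<notin> \<Lambda>" "a1 - c \<notin> \<Lambda>" "a2 - c \<notin> \<Lambda>"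
    using nl lattice_minus_commute[of c] by auto
  have zc: "\<zeta> (x - c) = - \<zeta> (c - x)" for x by (rule zeta_minus_commute)
  have "(\<zeta> (a1 - a) + \<zeta> a - \<zeta> a1) * (\<zeta> a + \<zeta> (a2 - a) - \<zeta> a2)
     - (\<zeta> (a1 - a) - \<zeta> (a2 - a) - \<zeta> (a1 - a2))
       * ((\<zeta> a + \<zeta> (a2 - a) - \<zeta> a2) - (\<zeta> (a1 - a) + \<zeta> a - \<zeta> a1))
     = p (a1 - a) + p a + p (a2 - a)"
    by (rule addition_lawD[OF p nl(8,1,9,4,5,10)]) simp_all
  then show "(\<zeta> (a1 - a) - \<zeta> (a2 - a) - \<zeta> (a1 - a2)) * (A a1 - A a2) = p (a1 - a) + p (a2 - a) + p a - A a1 * A a2"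
    unfolding A_def by algebra
  have "(\<zeta> (a1 - a) + \<zeta> (- b) - \<zeta> (a1 - c)) * (\<zeta> (- b) + \<zeta> (a2 - a) - \<zeta> (a2 - c))
     - (\<zeta> (a1 - a) - \<zeta> (a2 - a) - \<zeta> (a1 - a2))
       * ((\<zeta> (- b) + \<zeta> (a2 - a) - \<zeta> (a2 - c)) - (\<zeta> (a1 - a) + \<zeta> (- b) - \<zeta> (a1 - c)))
     = p (a1 - a) + p (- b) + p (a2 - a)"
    by (rule addition_lawD[OF p nl(8) nl'(1) nl(9) nl'(2,3) nl(10)]) (simp_all add: c)
  then show "(\<zeta> (a1 - a) - \<zeta> (a2 - a) - \<zeta> (a1 - a2)) * (M a1 - M a2) = p (a1 - a) + p (a2 - a) + p (- b) - M a1 * M a2"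
    unfolding M_def zc zeta_uminus by algebra
  have *: "p (x - a) = A x * M x - l * (M x - A x) - p a - p (- b)"
    if "x - a \<notin> \<Lambda>" "x \<notin> \<Lambda>" "x - c \<notin> \<Lambda>" for x
  proof -
    have "(\<zeta> a + \<zeta> (x - a) - \<zeta> x) * (\<zeta> (x - a) + \<zeta> (- b) - \<zeta> (x - c))
      - (\<zeta> a - \<zeta> (- b) - \<zeta> c)
        * ((\<zeta> (x - a) + \<zeta> (- b) - \<zeta> (x - c)) - (\<zeta> a + \<zeta> (x - a) - \<zeta> x))
      = p a + p (x - a) + p (- b)"
      by (rule addition_lawD[OF p nl(1) that(1) nl'(1) that(2,3) nl(3)]) (simp_all add: c)
    then show ?thesis unfolding M_def A_def l_def zc zeta_uminus by algebra
  qed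
  show "p (a1 - a) = A a1 * M a1 - l * (M a1 - A a1) - p a - p (- b)"
    by (rule *[OF nl(8,4) nl'(2)])
  show "p (a2 - a) = A a2 * M a2 - l * (M a2 - A a2) - p a - p (- b)"
    by (rule *[OF nl(9,5) nl'(3)])
qed (rule stat)

text \<open>The instance x, c - x - y, - (c - x) of the addition law, whose two sums are c - y and -
  y and whose difference is c.\<close>

lemma third_product:
  assumes p: "addition_law p"
    and nl: "x \<notin> \<Lambda>" "y \<notin> \<Lambda>" "c - x \<notin> \<Lambda>" "c - y \<notin> \<Lambda>" "c \<notin> \<Lambda>" "c - x - y \<notin> \<Lambda>"
  shows "(\<zeta> (c - x - y) + \<zeta> x - \<zeta> (c - y)) * (\<zeta> (c - x - y) + \<zeta> y - \<zeta> (c - x))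
    - (\<zeta> x + \<zeta> (c - x) - \<zeta> c) * ((\<zeta> y + \<zeta> (c - y) - \<zeta> c) - (\<zeta> x + \<zeta> (c - x) - \<zeta> c))
    = p x + p (c - x - y) + p (- (c - x))"
proof -
  have nl': "- (c - x) \<notin> \<Lambda>" "- y \<notin> \<Lambda>" using nl by (simp_all del: minus_diff_eq)
  have "(\<zeta> x + \<zeta> (c - x - y) - \<zeta> (c - y)) * (\<zeta> (c - x - y) + \<zeta> (- (c - x)) - \<zeta> (- y))
    - (\<zeta> x - \<zeta> (- (c - x)) - \<zeta> c)
      * ((\<zeta> (c - x - y) + \<zeta> (- (c - x)) - \<zeta> (- y)) - (\<zeta> x + \<zeta> (c - x - y) - \<zeta> (c - y)))
    = p x + p (c - x - y) + p (- (c - x))"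
    by (rule addition_lawD[OF p nl(1,6) nl'(1) nl(4) nl'(2) nl(5)]) simp_all
  then show ?thesis unfolding zeta_uminus by algebra
qed

text \<open>The leading product in \<open>third_product\<close> is symmetric in x and y, so
  subtracting the two instances leaves an equality of one expression at x and at y. Up to a
  constant, the common value is the Weierstrass p function at c: both chords pass through -
  c.\<close>

lemma third_constant:
  assumes p: "addition_law p"
    and nl: "x \<notin> \<Lambda>" "y \<notin> \<Lambda>" "c - x \<notin> \<Lambda>" "c - y \<notin> \<Lambda>" "c \<notin> \<Lambda>" "c - x - y \<notin> \<Lambda>"
  shows "(\<zeta> x + \<zeta> (c - x) - \<zeta> c)\<^sup>2 - p x - p (- (c - x)) = (\<zeta> y + \<zeta> (c - y) - \<zeta> c)\<^sup>2 - p y - p (- (c - y))"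
proof -
  have swap: "c - y - x = c - x - y" by simp
  note third_product[OF p nl] third_product[OF p nl(2,1,4,3,5) nl(6)[folded swap], unfolded swap]
  then show ?thesis by algebra
qed

text \<open>Here \<open>c - a2 - a3\<close> is \<open>x1 - u3\<close> and \<open>c - a1 - a3\<close> is \<open>x2 - u3\<close>; no stationarity is needed.\<close>
lemma relation_third:
  fixes a1 a2 a3 c :: complex and p :: "complex \<Rightarrow> complex"
  defines "l \<equiv> \<lambda>x. \<zeta> x + \<zeta> (c - x) - \<zeta> c"
  defines "R \<equiv> \<lambda>x y. 2 * \<zeta> (c - x - y) + \<zeta> x + \<zeta> y - \<zeta> (c - x) - \<zeta> (c - y)"
  defines "q \<equiv> \<lambda>x. (l x)\<^sup>2 - p x - p (- (c - x))"
  assumes p: "addition_law p"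
    and nl: "c \<notin> \<Lambda>" "a1 \<notin> \<Lambda>" "a2 \<notin> \<Lambda>" "a3 \<notin> \<Lambda>" "c - a1 \<notin> \<Lambda>" "c - a2 \<notin> \<Lambda>" "c - a3 \<notin> \<Lambda>"
      "c - a2 - a3 \<notin> \<Lambda>" "c - a1 - a3 \<notin> \<Lambda>" "a1 - a2 \<notin> \<Lambda>"
  shows "2 * (\<zeta> (c - a2 - a3) - \<zeta> (c - a1 - a3) - \<zeta> (a1 - a2)) * (R a2 a3 - R a1 a3) =
    (R a2 a3)\<^sup>2 + (R a1 a3)\<^sup>2 - R a2 a3 * R a1 a3
      + (6 * q a3 - ((l a1)\<^sup>2 + (l a2)\<^sup>2 + (l a3)\<^sup>2 + l a1 * l a2 + l a1 * l a3 + l a2 * l a3))"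
proof -
  \<comment> \<open>\<open>R x y\<close> is the sum of this slope expression and its mirror image
    under x <-> y, which differs from it by \<open>l y - l x\<close>.\<close>
  define F where "F x y = \<zeta> (c - x - y) + \<zeta> x - \<zeta> (c - y)" for x y
  have nl': "- (c - a3) \<notin> \<Lambda>" "- a1 \<notin> \<Lambda>" "- a2 \<notin> \<Lambda>" using nl by (simp_all del: minus_diff_eq)
  have R: "R x y = F x y + (F x y - l x + l y)" for x y
    by (simp add: R_def F_def l_def)
  have step: "\<zeta> (c - x - y) + \<zeta> y - \<zeta> (c - x) = F x y - l x + l y" for x y
    by (simp add: F_def l_def)
  have T1: "(\<zeta> (c - a2 - a3) - \<zeta> (c - a1 - a3) - \<zeta> (a1 - a2)) * ((F a2 a3 - l a2 + l a3) - (F a1 a3 - l a1 + l a3))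
      = p (c - a2 - a3) + p (c - a1 - a3) + p a3 - (F a2 a3 - l a2 + l a3) * (F a1 a3 - l a1 + l a3)"
  proof -
    have "(\<zeta> (c - a2 - a3) + \<zeta> a3 - \<zeta> (c - a2)) * (\<zeta> a3 + \<zeta> (c - a1 - a3) - \<zeta> (c - a1))
      - (\<zeta> (c - a2 - a3) - \<zeta> (c - a1 - a3) - \<zeta> (a1 - a2))
        * ((\<zeta> a3 + \<zeta> (c - a1 - a3) - \<zeta> (c - a1)) - (\<zeta> (c - a2 - a3) + \<zeta> a3 - \<zeta> (c - a2)))
      = p (c - a2 - a3) + p a3 + p (c - a1 - a3)"
      by (rule addition_lawD[OF p nl(8,4,9,6,5,10)]) simp_all
    then show ?thesis unfolding step[symmetric] by algebra
  qed
  have T2: "(\<zeta> (c - a2 - a3) - \<zeta> (c - a1 - a3) - \<zeta> (a1 - a2)) * (F a2 a3 - F a1 a3)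
      = p (c - a2 - a3) + p (c - a1 - a3) + p (- (c - a3)) - F a2 a3 * F a1 a3"
  proof -
    have "(\<zeta> (c - a2 - a3) + \<zeta> (- (c - a3)) - \<zeta> (- a2)) * (\<zeta> (- (c - a3)) + \<zeta> (c - a1 - a3) - \<zeta> (- a1))
      - (\<zeta> (c - a2 - a3) - \<zeta> (c - a1 - a3) - \<zeta> (a1 - a2))
        * ((\<zeta> (- (c - a3)) + \<zeta> (c - a1 - a3) - \<zeta> (- a1)) - (\<zeta> (c - a2 - a3) + \<zeta> (- (c - a3)) - \<zeta> (- a2)))
      = p (c - a2 - a3) + p (- (c - a3)) + p (c - a1 - a3)"
      by (rule addition_lawD[OF p nl(8) nl'(1) nl(9) nl'(3,2) nl(10)]) simp_all
    then show ?thesis unfolding F_def zeta_uminus by algebra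
  qed
  have P: "p (c - x - a3) = F x a3 * (F x a3 - l x + l a3) - l x * ((F x a3 - l x + l a3) - F x a3) - ((l x)\<^sup>2 - q a3)"
    if "x \<notin> \<Lambda>" "c - x \<notin> \<Lambda>" "c - x - a3 \<notin> \<Lambda>" for x
  proof -
    have "F x a3 * (F x a3 - l x + l a3) - l x * (l a3 - l x) = p x + p (c - x - a3) + p (- (c - x))"
      using third_product[OF p that(1) nl(4) that(2) nl(7,1) that(3)]
      unfolding step by (simp add: F_def l_def)
    moreover have "q x = q a3"
      unfolding q_def l_def by (rule third_constant[OF p that(1) nl(4) that(2) nl(7,1) that(3)])
    ultimately show ?thesis unfolding q_def by algebra
  qed
  show ?thesis unfolding R
    by (rule relation_third_algebra[OF T1 T2 P[OF nl(3,6,8)] P[OF nl(2,5,9)]]) (simp_all add: q_def)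
qed

text \<open>Here rho_x = A x + M x = 2 zeta(x - a) - m x + zeta(a) - zeta(b). The bracket starting
  with \<open>\<zeta> b - 2 * \<zeta> c\<close> is the s-derivative of log kappa.\<close>

lemma separation_first:
  fixes a1 a2 a3 a b c :: complex
  defines "m \<equiv> \<lambda>x. \<zeta> x - \<zeta> (c - x)"
  assumes c: "c = a + b"
    and nl: "a \<notin> \<Lambda>" "b \<notin> \<Lambda>" "c \<notin> \<Lambda>" "a1 \<notin> \<Lambda>" "a2 \<notin> \<Lambda>" "a3 \<notin> \<Lambda>"
      "c - a1 \<notin> \<Lambda>" "c - a2 \<notin> \<Lambda>" "c - a3 \<notin> \<Lambda>"
      "a1 - a \<notin> \<Lambda>" "a2 - a \<notin> \<Lambda>" "a3 - a \<notin> \<Lambda>" "a1 - a2 \<notin> \<Lambda>" "a1 - a3 \<notin> \<Lambda>" "a2 - a3 \<notin> \<Lambda>"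
    and stat: "\<zeta> a + \<zeta> b - 4 * \<zeta> c + (\<zeta> a1 + \<zeta> (c - a1)) + (\<zeta> a2 + \<zeta> (c - a2)) + (\<zeta> a3 + \<zeta> (c - a3)) = 0"
  shows "frakB w1 w2 (m a1 - m a3) (m a2 - m a3) a1 a2 a3 a = 0"
    and "(m a2 - m a3 + 2 * \<zeta> (a - a2) - 2 * \<zeta> (a - a3)) *
      (\<zeta> (a1 - a2) - \<zeta> (a3 - a) + m a2 + m a3 + (\<zeta> b - 2 * \<zeta> c + \<zeta> (c - a1) + \<zeta> (c - a2) + \<zeta> (c - a3)))
      = (m a1 - m a3 + 2 * \<zeta> (a - a1) - 2 * \<zeta> (a - a3)) *
        (\<zeta> (a - a3) - \<zeta> (a - a2) + \<zeta> (a1 - a2) - \<zeta> (a1 - a3))"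
proof -
  obtain p where p: "addition_law p" using addition_law_exists by blast
  define A where "A x = \<zeta> (x - a) + \<zeta> a - \<zeta> x" for x
  define M where "M x = \<zeta> (x - a) - \<zeta> b + \<zeta> (c - x)" for x
  define K where "K = (M a1 - A a1) * (M a2 - A a2) + (M a1 - A a1) * (M a3 - A a3) + (M a2 - A a2) * (M a3 - A a3)
         - 6 * (p a + p (- b))"
  have s: "4 * (\<zeta> a + \<zeta> b - \<zeta> c) + (M a1 - A a1) + (M a2 - A a2) + (M a3 - A a3) = 0"
    using stat unfolding A_def M_def by algebra
  then have s': "4 * (\<zeta> a + \<zeta> b - \<zeta> c) + (M a1 - A a1) + (M a3 - A a3) + (M a2 - A a2) = 0"
    "4 * (\<zeta> a + \<zeta> b - \<zeta> c) + (M a2 - A a2) + (M a3 - A a3) + (M a1 - A a1) = 0"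
    by algebra+
  note rel = relation_first[OF p c, folded A_def M_def]
  have r12: "2 * (\<zeta> (a1 - a) - \<zeta> (a2 - a) - \<zeta> (a1 - a2)) * ((A a1 + M a1) - (A a2 + M a2)) =
    (A a1 + M a1)\<^sup>2 + (A a2 + M a2)\<^sup>2 - (A a1 + M a1) * (A a2 + M a2) + K"
    unfolding K_def by (rule rel[OF nl(1-3,4,5,7,8,10,11,13) s])
  have r13: "2 * (\<zeta> (a1 - a) - \<zeta> (a3 - a) - \<zeta> (a1 - a3)) * ((A a1 + M a1) - (A a3 + M a3)) =
    (A a1 + M a1)\<^sup>2 + (A a3 + M a3)\<^sup>2 - (A a1 + M a1) * (A a3 + M a3) + K"
    using rel[OF nl(1-3,4,6,7,9,10,12,14) s'(1)] unfolding K_def by algebra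
  have r23: "2 * (\<zeta> (a2 - a) - \<zeta> (a3 - a) - \<zeta> (a2 - a3)) * ((A a2 + M a2) - (A a3 + M a3)) =
    (A a2 + M a2)\<^sup>2 + (A a3 + M a3)\<^sup>2 - (A a2 + M a2) * (A a3 + M a3) + K"
    using rel[OF nl(1-3,5,6,8,9,11,12,15) s'(2)] unfolding K_def by algebra
  have r: "m x - m a3 + 2 * (\<zeta> (a3 - a) - \<zeta> (x - a)) = (A a3 + M a3) - (A x + M x)" for x
    unfolding m_def A_def M_def by algebra
  note concl = separation_conclusion[OF r12 r13 r23 r r]
  show "frakB w1 w2 (m a1 - m a3) (m a2 - m a3) a1 a2 a3 a = 0" by (rule concl(1))
  \<comment> \<open>With k for that bracket, stationarity reads 2 k + m a1 + m a2 + m a3 + zeta(a) -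
    zeta(b) = 0, which removes the constant of the rho's.\<close>
  have "(A a1 + M a1) - (A a2 + M a2) - (A a3 + M a3) - 2 * (\<zeta> (a1 - a) - \<zeta> (a2 - a) - \<zeta> (a1 - a2)) =
    2 * (\<zeta> (a1 - a2) - \<zeta> (a3 - a) + m a2 + m a3 + (\<zeta> b - 2 * \<zeta> c + \<zeta> (c - a1) + \<zeta> (c - a2) + \<zeta> (c - a3)))"
    using stat unfolding A_def M_def m_def by algebra
  note cancel_two[OF concl(2)[unfolded this]]
  then
  show "(m a2 - m a3 + 2 * \<zeta> (a - a2) - 2 * \<zeta> (a - a3)) *
      (\<zeta> (a1 - a2) - \<zeta> (a3 - a) + m a2 + m a3 + (\<zeta> b - 2 * \<zeta> c + \<zeta> (c - a1) + \<zeta> (c - a2) + \<zeta> (c - a3)))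
      = (m a1 - m a3 + 2 * \<zeta> (a - a1) - 2 * \<zeta> (a - a3)) *
        (\<zeta> (a - a3) - \<zeta> (a - a2) + \<zeta> (a1 - a2) - \<zeta> (a1 - a3))" .
qed

lemma separation_third:
  fixes a1 a2 a3 u c :: complex
  defines "m \<equiv> \<lambda>x. \<zeta> x - \<zeta> (c - x)"
  assumes u: "u = a1 + a2 + a3 - c"
    and nl: "c \<notin> \<Lambda>" "a1 \<notin> \<Lambda>" "a2 \<notin> \<Lambda>" "a3 \<notin> \<Lambda>" "c - a1 \<notin> \<Lambda>" "c - a2 \<notin> \<Lambda>" "c - a3 \<notin> \<Lambda>"
      "a1 - u \<notin> \<Lambda>" "a2 - u \<notin> \<Lambda>" "a3 - u \<notin> \<Lambda>" "a1 - a2 \<notin> \<Lambda>" "a1 - a3 \<notin> \<Lambda>" "a2 - a3 \<notin> \<Lambda>"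
  shows "frakB w1 w2 (m a1 - m a3) (m a2 - m a3) a1 a2 a3 u = 0"
    and "(m a2 - m a3 + 2 * \<zeta> (u - a2) - 2 * \<zeta> (u - a3)) * (\<zeta> (a1 - a2) - \<zeta> (a3 - u) - m a1)
      = (m a1 - m a3 + 2 * \<zeta> (u - a1) - 2 * \<zeta> (u - a3)) *
        (\<zeta> (u - a3) - \<zeta> (u - a2) + \<zeta> (a1 - a2) - \<zeta> (a1 - a3))"
proof -
  obtain p where p: "addition_law p" using addition_law_exists by blast
  define l where "l x = \<zeta> x + \<zeta> (c - x) - \<zeta> c" for x
  define R where "R x y = 2 * \<zeta> (c - x - y) + \<zeta> x + \<zeta> y - \<zeta> (c - x) - \<zeta> (c - y)" for x y
  define q where "q x = (l x)\<^sup>2 - p x - p (- (c - x))" for x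
  define K where "K = 6 * q a3 - ((l a1)\<^sup>2 + (l a2)\<^sup>2 + (l a3)\<^sup>2 + l a1 * l a2 + l a1 * l a3 + l a2 * l a3)"
  have X: "a1 - u = c - a2 - a3" "a2 - u = c - a1 - a3" "a3 - u = c - a1 - a2" by (simp_all add: u)
  have X': "c - a3 - a2 = c - a2 - a3" "c - a3 - a1 = c - a1 - a3" "c - a2 - a1 = c - a1 - a2" by simp_all
  have Rc: "R x y = R y x" for x y
  proof -
    have swap: "\<zeta> (c - x - y) = \<zeta> (c - y - x)" by (rule arg_cong[of _ _ \<zeta>]) simp
    show ?thesis unfolding R_def swap by simp
  qed
  have nl': "c - a3 - a2 \<notin> \<Lambda>" "c - a1 - a2 \<notin> \<Lambda>" "c - a2 - a1 \<notin> \<Lambda>" "c - a3 - a1 \<notin> \<Lambda>"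
    using nl(8-10) unfolding X X' by simp_all
  \<comment> \<open>Each pair yields its own constant, with \<open>q\<close> at the remaining point;
    this equality makes \<open>K\<close> common.\<close>
  have q: "q a2 = q a3" "q a1 = q a3"
    using third_constant[OF p nl(3,4,6,7,1) nl(8)[unfolded X]] third_constant[OF p nl(2,4,5,7,1) nl(9)[unfolded X]]
    unfolding q_def l_def by simp_all
  note rel = relation_third[where c = c, OF p, folded l_def R_def, folded q_def]
  have r12: "2 * (\<zeta> (a1 - u) - \<zeta> (a2 - u) - \<zeta> (a1 - a2)) * (R a2 a3 - R a1 a3) =
    (R a2 a3)\<^sup>2 + (R a1 a3)\<^sup>2 - R a2 a3 * R a1 a3 + K"
    unfolding K_def X by (rule rel[OF nl(1-7) nl(8,9)[unfolded X] nl(11)])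
  have r13: "2 * (\<zeta> (a1 - u) - \<zeta> (a3 - u) - \<zeta> (a1 - a3)) * (R a2 a3 - R a1 a2) =
    (R a2 a3)\<^sup>2 + (R a1 a2)\<^sup>2 - R a2 a3 * R a1 a2 + K"
    using rel[OF nl(1,2,4,3,5,7,6) nl'(1,2) nl(12)] unfolding K_def X X' Rc[of a3 a2] q by algebra
  have r23: "2 * (\<zeta> (a2 - u) - \<zeta> (a3 - u) - \<zeta> (a2 - a3)) * (R a1 a3 - R a1 a2) =
    (R a1 a3)\<^sup>2 + (R a1 a2)\<^sup>2 - R a1 a3 * R a1 a2 + K"
    using rel[OF nl(1,3,4,2,6,7,5) nl'(4,3) nl(13)] unfolding K_def X X' Rc[of a3 a1] Rc[of a2 a1] q by algebra
  have r: "m a1 - m a3 + 2 * (\<zeta> (a3 - u) - \<zeta> (a1 - u)) = R a1 a2 - R a2 a3"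
    "m a2 - m a3 + 2 * (\<zeta> (a3 - u) - \<zeta> (a2 - u)) = R a1 a2 - R a1 a3"
    unfolding m_def R_def X by algebra+
  note concl = separation_conclusion[OF r12 r13 r23 r]
  show "frakB w1 w2 (m a1 - m a3) (m a2 - m a3) a1 a2 a3 u = 0" by (rule concl(1))
  have "R a2 a3 - R a1 a3 - R a1 a2 - 2 * (\<zeta> (a1 - u) - \<zeta> (a2 - u) - \<zeta> (a1 - a2)) =
    2 * (\<zeta> (a1 - a2) - \<zeta> (a3 - u) - m a1)"
    unfolding R_def m_def X by algebra
  note cancel_two[OF concl(2)[unfolded this]]
  then
  show "(m a2 - m a3 + 2 * \<zeta> (u - a2) - 2 * \<zeta> (u - a3)) * (\<zeta> (a1 - a2) - \<zeta> (a3 - u) - m a1)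
      = (m a1 - m a3 + 2 * \<zeta> (u - a1) - 2 * \<zeta> (u - a3)) *
        (\<zeta> (u - a3) - \<zeta> (u - a2) + \<zeta> (a1 - a2) - \<zeta> (a1 - a3))" .
qed

section \<open>Derivatives of the generating function\<close>

lemma sigma_compose_has_derivative:
  assumes "(f has_derivative f') (at p)" "f p \<notin> \<Lambda>"
  shows "((\<lambda>q. \<sigma> (f q)) has_derivative (\<lambda>h. \<sigma> (f p) * (\<zeta> (f p) * f' h))) (at p)"
  using has_derivative_compose_field[OF sigma_deriv[OF assms(2)] assms(1)] by (simp add: mult.assoc)

text \<open>A lattice point in the denominator also makes kappa vanish, because division by zero
  gives 0.\<close>

lemma kappa_nonlattice:
  assumes "kappa w1 w2 t1 t2 t3 s z \<noteq> 0"
  shows "z \<notin> \<Lambda>" "z + s \<notin> \<Lambda>" "2 * z + s \<notin> \<Lambda>" "z + t1 \<notin> \<Lambda>" "z + t2 \<notin> \<Lambda>" "z + t3 \<notin> \<Lambda>"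
    "z + s - t1 \<notin> \<Lambda>" "z + s - t2 \<notin> \<Lambda>" "z + s - t3 \<notin> \<Lambda>"
  using assms unfolding kappa_def by (auto simp: sigma_eq_0_iff)

text \<open>All five arguments may vary. Grouping by z', t_i', s' isolates the stationarity
  expression as the coefficient of z'; constant t_i and s recover the partial derivative in
  z.\<close>

lemma kappa_has_derivative:
  fixes t1 t2 t3 s z :: "'a::real_normed_vector \<Rightarrow> complex"
  assumes d: "(t1 has_derivative t1') (at p)" "(t2 has_derivative t2') (at p)" "(t3 has_derivative t3') (at p)"
      "(s has_derivative s') (at p)" "(z has_derivative z') (at p)"
    and nz: "kappa w1 w2 (t1 p) (t2 p) (t3 p) (s p) (z p) \<noteq> 0"
  defines "m \<equiv> \<lambda>t. \<zeta> (z p + t p) - \<zeta> (z p + s p - t p)"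
  shows "((\<lambda>q. kappa w1 w2 (t1 q) (t2 q) (t3 q) (s q) (z q)) has_derivative
    (\<lambda>h. kappa w1 w2 (t1 p) (t2 p) (t3 p) (s p) (z p) *
      ((\<zeta> (z p) + \<zeta> (z p + s p) - 4 * \<zeta> (2 * z p + s p)
         + (\<zeta> (z p + t1 p) + \<zeta> (z p + s p - t1 p)) + (\<zeta> (z p + t2 p) + \<zeta> (z p + s p - t2 p))
         + (\<zeta> (z p + t3 p) + \<zeta> (z p + s p - t3 p))) * z' h
       + m t1 * t1' h + m t2 * t2' h + m t3 * t3' h
       + (\<zeta> (z p + s p) - 2 * \<zeta> (2 * z p + s p)
          + \<zeta> (z p + s p - t1 p) + \<zeta> (z p + s p - t2 p) + \<zeta> (z p + s p - t3 p)) * s' h))) (at p)"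
proof -
  note nl = kappa_nonlattice[OF nz]
  note dzs = has_derivative_add[OF d(5) d(4)]
  have dc: "((\<lambda>q. 2 * z q + s q) has_derivative (\<lambda>h. 2 * z' h + s' h)) (at p)"
    by (intro has_derivative_add has_derivative_mult_right d)
  note S = sigma_compose_has_derivative
  note pair = has_derivative_mult_log[OF S[OF has_derivative_add[OF d(5)]] S[OF has_derivative_diff[OF dzs]]]
  note K = has_derivative_mult_log[OF has_derivative_divide_log[OF
      has_derivative_mult_log[OF S[OF d(5) nl(1)] S[OF dzs nl(2)]]
      has_derivative_mult_log[OF S[OF dc nl(3)] S[OF dc nl(3)]]]
     has_derivative_mult_log[OF pair[OF d(1) nl(4) d(1) nl(7)]
       has_derivative_mult_log[OF pair[OF d(2) nl(5) d(2) nl(8)] pair[OF d(3) nl(6) d(3) nl(9)]]]]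
  have k: "kappa w1 w2 t1 t2 t3 s z = \<sigma> z * \<sigma> (z + s) / (\<sigma> (2 * z + s) * \<sigma> (2 * z + s)) *
     (\<sigma> (z + t1) * \<sigma> (z + s - t1) * (\<sigma> (z + t2) * \<sigma> (z + s - t2) * (\<sigma> (z + t3) * \<sigma> (z + s - t3))))"
    for t1 t2 t3 s z
    by (simp add: kappa_def power2_eq_square mult.assoc)
  have "\<sigma> (2 * z p + s p) * \<sigma> (2 * z p + s p) \<noteq> 0" using nl(3) by (simp add: sigma_eq_0_iff)
  note K = K[OF this, folded k]
  show ?thesis
    by (rule has_derivative_eq_rhs[OF K]) (simp add: fun_eq_iff m_def algebra_simps)
qed

lemma kappa_stationary:
  assumes stat: "((\<lambda>z. kappa w1 w2 t1 t2 t3 s z) has_field_derivative 0) (at z)"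
    and nz: "kappa w1 w2 t1 t2 t3 s z \<noteq> 0"
  shows "\<zeta> z + \<zeta> (z + s) - 4 * \<zeta> (2 * z + s)
         + (\<zeta> (z + t1) + \<zeta> (z + s - t1)) + (\<zeta> (z + t2) + \<zeta> (z + s - t2)) + (\<zeta> (z + t3) + \<zeta> (z + s - t3)) = 0"
    (is "?S = 0")
proof -
  have "((\<lambda>z. kappa w1 w2 t1 t2 t3 s z) has_derivative (\<lambda>h. kappa w1 w2 t1 t2 t3 s z * ?S * h)) (at z)"
    using kappa_has_derivative[OF has_derivative_const has_derivative_const has_derivative_const
        has_derivative_const has_derivative_ident nz] by (simp add: mult.assoc)
  then have "((\<lambda>z. kappa w1 w2 t1 t2 t3 s z) has_field_derivative kappa w1 w2 t1 t2 t3 s z * ?S) (at z)"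
    by (simp add: has_field_derivative_def)
  with stat have "kappa w1 w2 t1 t2 t3 s z * ?S = 0" using DERIV_unique by blast
  then show ?thesis using nz by simp
qed

text \<open>Existence of the logarithm \<open>L\<close> already forces every sigma factor to be
  nonzero, which supplies the lattice conditions.\<close>

lemma log_prefactor_has_derivative:
  assumes "open \<Omega>" "p \<in> \<Omega>" "continuous_on \<Omega> L"
    and L: "\<forall>p\<in>\<Omega>. exp (L p) = (\<Prod>i\<leftarrow>[1,2,3]. \<sigma> (p$i)) /
              ((\<Prod>j\<leftarrow>[1,2,3]. \<sigma> (uu j p)) * \<sigma> (p$1 - p$2) * \<sigma> (p$1 - p$3) * \<sigma> (p$2 - p$3))"
  shows "(L has_derivative (\<lambda>h. \<zeta> (p$1) * h$1 + \<zeta> (p$2) * h$2 + \<zeta> (p$3) * h$3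
     - \<zeta> (uu1 p) * uu1 h - \<zeta> (uu2 p) * uu2 h - \<zeta> (uu3 p) * uu3 h
     - \<zeta> (p$1 - p$2) * (h$1 - h$2) - \<zeta> (p$1 - p$3) * (h$1 - h$3) - \<zeta> (p$2 - p$3) * (h$2 - h$3))) (at p)"
    and "p$1 - p$2 \<notin> \<Lambda>" "p$1 - p$3 \<notin> \<Lambda>" "p$2 - p$3 \<notin> \<Lambda>"
proof -
  let ?N = "\<lambda>q::complex^6. \<sigma> (q$1) * (\<sigma> (q$2) * \<sigma> (q$3))"
  let ?D = "\<lambda>q::complex^6. \<sigma> (uu1 q) * (\<sigma> (uu2 q) * \<sigma> (uu3 q)) * \<sigma> (q$1 - q$2) * \<sigma> (q$1 - q$3) * \<sigma> (q$2 - q$3)"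
  have exp: "exp (L q) = ?N q / ?D q" if "q \<in> \<Omega>" for q
    unfolding bspec[OF L that] by (simp only: list.map prod_list.Cons prod_list.Nil mult_1_right uu_simps)
  have "?N p / ?D p \<noteq> 0" using exp[OF assms(2)] by (metis exp_not_eq_zero)
  then have nl: "p$1 \<notin> \<Lambda>" "p$2 \<notin> \<Lambda>" "p$3 \<notin> \<Lambda>" "uu1 p \<notin> \<Lambda>" "uu2 p \<notin> \<Lambda>" "uu3 p \<notin> \<Lambda>"
     "p$1 - p$2 \<notin> \<Lambda>" "p$1 - p$3 \<notin> \<Lambda>" "p$2 - p$3 \<notin> \<Lambda>" and D: "?D p \<noteq> 0"
    by (auto simp: sigma_eq_0_iff)
  show "p$1 - p$2 \<notin> \<Lambda>" "p$1 - p$3 \<notin> \<Lambda>" "p$2 - p$3 \<notin> \<Lambda>" by (rule nl)+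
  note lin = linear_coordinates[THEN linear_has_derivative]
  note S = sigma_compose_has_derivative
  note M = has_derivative_mult_log
  note N = M[OF S[OF lin(1) nl(1)] M[OF S[OF lin(1) nl(2)] S[OF lin(1) nl(3)]]]
  note D' = M[OF M[OF M[OF M[OF S[OF lin(3) nl(4)] M[OF S[OF lin(4) nl(5)] S[OF lin(5) nl(6)]]]
        S[OF has_derivative_diff[OF lin(1) lin(1)] nl(7)]]
        S[OF has_derivative_diff[OF lin(1) lin(1)] nl(8)]]
        S[OF has_derivative_diff[OF lin(1) lin(1)] nl(9)]]
  show "(L has_derivative (\<lambda>h. \<zeta> (p$1) * h$1 + \<zeta> (p$2) * h$2 + \<zeta> (p$3) * h$3
     - \<zeta> (uu1 p) * uu1 h - \<zeta> (uu2 p) * uu2 h - \<zeta> (uu3 p) * uu3 h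
     - \<zeta> (p$1 - p$2) * (h$1 - h$2) - \<zeta> (p$1 - p$3) * (h$1 - h$3) - \<zeta> (p$2 - p$3) * (h$2 - h$3))) (at p)"
    by (rule has_derivative_eq_rhs[OF has_derivative_log_branch[OF
          has_derivative_divide_log[OF N D' D] assms(1-3) exp]])
      (simp_all add: fun_eq_iff algebra_simps)
qed

text \<open>The derivative of \<open>zs\<close> enters only multiplied by the stationarity
  expression, which is 0.\<close>

lemma log_kappa_has_derivative:
  assumes "open \<Omega>" "p \<in> \<Omega>" "continuous_on \<Omega> Fb"
    and zs: "zs differentiable (at (tsv p))"
    and Fb: "\<forall>p\<in>\<Omega>. exp (Fb p) = kappa w1 w2 (tsv p $ 1) (tsv p $ 2) (tsv p $ 3) (tsv p $ 4) (zs (tsv p))"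
    and stat: "((\<lambda>z. kappa w1 w2 (tsv p $ 1) (tsv p $ 2) (tsv p $ 3) (tsv p $ 4) z)
        has_field_derivative 0) (at (zs (tsv p)))"
  defines "z \<equiv> zs (tsv p)"
  defines "c \<equiv> 2 * z + (uu2 p - uu1 p)"
  defines "a \<equiv> \<lambda>i. z + (p$i - uu1 p)"
  defines "m \<equiv> \<lambda>i. \<zeta> (a i) - \<zeta> (c - a i)"
  shows "(Fb has_derivative (\<lambda>h. m 1 * (h$1 - uu1 h) + m 2 * (h$2 - uu1 h) + m 3 * (h$3 - uu1 h)
       + (\<zeta> (z + (uu2 p - uu1 p)) - 2 * \<zeta> c + \<zeta> (c - a 1) + \<zeta> (c - a 2) + \<zeta> (c - a 3)) * (uu2 h - uu1 h))) (at p)"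
proof -
  have nz: "kappa w1 w2 (p$1 - uu1 p) (p$2 - uu1 p) (p$3 - uu1 p) (uu2 p - uu1 p) z \<noteq> 0"
    using Fb assms(2) unfolding tsv_nth z_def by (metis exp_not_eq_zero)
  note lin = linear_coordinates[THEN linear_has_derivative]
  obtain zd where zd: "(zs has_derivative zd) (at (tsv p))"
    using zs unfolding differentiable_def by blast
  note z' = has_derivative_compose[OF lin(6) zd]
  note stat' = kappa_stationary[OF stat[unfolded tsv_nth, folded z_def] nz]
  have x: "z + (uu2 p - uu1 p) - (p$i - uu1 p) = c - a i" for i
    by (simp add: c_def a_def)
  note K = kappa_has_derivative[OF has_derivative_diff[OF lin(1) lin(3)] has_derivative_diff[OF lin(1) lin(3)]
     has_derivative_diff[OF lin(1) lin(3)] has_derivative_diff[OF lin(4) lin(3)] z', folded z_def, OF nz,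
     unfolded stat']
  show ?thesis
    by (rule has_derivative_eq_rhs[OF has_derivative_log_branch[OF K[unfolded z_def] assms(1-3)]])
      (use Fb in \<open>simp_all add: tsv_nth m_def a_def c_def z_def\<close>)
qed

lemma separation_equations:
  fixes x1 x2 x3 u1 u2 u3 z :: complex
  defines "b \<equiv> z + (u2 - u1)" and "c \<equiv> 2 * z + (u2 - u1)" and "a \<equiv> \<lambda>x. z + (x - u1)"
  defines "m \<equiv> \<lambda>x. \<zeta> (a x) - \<zeta> (c - a x)"
  defines "k \<equiv> \<zeta> b - 2 * \<zeta> c + \<zeta> (c - a x1) + \<zeta> (c - a x2) + \<zeta> (c - a x3)"
  assumes u3: "u3 = x1 + x2 + x3 - u1 - u2"
    and nz: "kappa w1 w2 (x1 - u1) (x2 - u1) (x3 - u1) (u2 - u1) z \<noteq> 0"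
    and stat: "((\<lambda>z. kappa w1 w2 (x1 - u1) (x2 - u1) (x3 - u1) (u2 - u1) z) has_field_derivative 0) (at z)"
    and xu: "\<forall>x\<in>{x1, x2, x3}. \<forall>u\<in>{u1, u2, u3}. x - u \<notin> \<Lambda>"
    and xx: "x1 - x2 \<notin> \<Lambda>" "x1 - x3 \<notin> \<Lambda>" "x2 - x3 \<notin> \<Lambda>"
  shows "frakB w1 w2 (m x1 - m x3) (m x2 - m x3) x1 x2 x3 u1 = 0"
    "frakB w1 w2 (m x1 - m x3) (m x2 - m x3) x1 x2 x3 u2 = 0"
    "frakB w1 w2 (m x1 - m x3) (m x2 - m x3) x1 x2 x3 u3 = 0"
    "(m x2 - m x3 + 2 * \<zeta> (u1 - x2) - 2 * \<zeta> (u1 - x3)) * (\<zeta> (x1 - x2) - \<zeta> (x3 - u1) + m x2 + m x3 + k)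
      = (m x1 - m x3 + 2 * \<zeta> (u1 - x1) - 2 * \<zeta> (u1 - x3)) *
        (\<zeta> (u1 - x3) - \<zeta> (u1 - x2) + \<zeta> (x1 - x2) - \<zeta> (x1 - x3))"
    "(m x2 - m x3 + 2 * \<zeta> (u2 - x2) - 2 * \<zeta> (u2 - x3)) * (\<zeta> (x1 - x2) - \<zeta> (x3 - u2) - k - m x1)
      = (m x1 - m x3 + 2 * \<zeta> (u2 - x1) - 2 * \<zeta> (u2 - x3)) *
        (\<zeta> (u2 - x3) - \<zeta> (u2 - x2) + \<zeta> (x1 - x2) - \<zeta> (x1 - x3))"
    "(m x2 - m x3 + 2 * \<zeta> (u3 - x2) - 2 * \<zeta> (u3 - x3)) * (\<zeta> (x1 - x2) - \<zeta> (x3 - u3) - m x1)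
      = (m x1 - m x3 + 2 * \<zeta> (u3 - x1) - 2 * \<zeta> (u3 - x3)) *
        (\<zeta> (u3 - x3) - \<zeta> (u3 - x2) + \<zeta> (x1 - x2) - \<zeta> (x1 - x3))"
proof -
  have cz: "c = z + b" "c = b + z" by (simp_all add: c_def b_def)
  have zst: "z + (u2 - u1) - (x - u1) = c - a x" for x by (simp add: c_def a_def)
  have az: "z + (x - u1) = a x" for x by (simp add: a_def)
  note kn = kappa_nonlattice[OF nz, unfolded zst, folded b_def c_def, unfolded az]
  note ks = kappa_stationary[OF stat nz, unfolded zst, folded b_def c_def, unfolded az]
  have ks': "\<zeta> b + \<zeta> z - 4 * \<zeta> c + (\<zeta> (a x1) + \<zeta> (c - a x1)) + (\<zeta> (a x2) + \<zeta> (c - a x2)) + (\<zeta> (a x3) + \<zeta> (c - a x3)) = 0"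
    using ks by algebra
  have d: "a x - z = x - u1" "a x - b = x - u2" "a x - (a x1 + a x2 + a x3 - c) = x - u3"
    "z - a x = u1 - x" "b - a x = u2 - x" "(a x1 + a x2 + a x3 - c) - a x = u3 - x" "a x - a y = x - y" for x y
    by (simp_all add: a_def b_def c_def u3)
  have nl: "x1 - u1 \<notin> \<Lambda>" "x2 - u1 \<notin> \<Lambda>" "x3 - u1 \<notin> \<Lambda>" "x1 - u2 \<notin> \<Lambda>" "x2 - u2 \<notin> \<Lambda>" "x3 - u2 \<notin> \<Lambda>"
    "x1 - u3 \<notin> \<Lambda>" "x2 - u3 \<notin> \<Lambda>" "x3 - u3 \<notin> \<Lambda>"
    using xu by simp_all
  \<comment> \<open>\<open>frakB\<close> depends on its points only through differences, so the
    common shift by z - u1 is harmless.\<close>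
  have tr: "frakB w1 w2 s t x1 x2 x3 u = frakB w1 w2 s t (a x1) (a x2) (a x3) v"
    if "v = u + (z - u1)" for s t u v
    using frakB_translate[of w1 w2 s t x1 "z - u1" x2 x3 u]
    by (simp add: that a_def algebra_simps)
  have v: "z = u1 + (z - u1)" "b = u2 + (z - u1)" "a x1 + a x2 + a x3 - c = u3 + (z - u1)"
    by (simp_all add: a_def b_def c_def u3)
  have m: "m x = \<zeta> (a x) - \<zeta> (c - a x)" for x by (simp add: m_def)
  note first = separation_first[OF cz(1) kn(1-9), unfolded d, folded m, OF nl(1-3) xx ks]
  \<comment> \<open>The roles of z and b are exchanged; c and \<open>m\<close> stay the
    same.\<close>
  note second = separation_first[OF cz(2) kn(2,1,3-9), unfolded d, folded m, OF nl(4-6) xx ks']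
  note third = separation_third[OF refl kn(3-9), unfolded d, folded m, OF nl(7-9) xx]
  show "frakB w1 w2 (m x1 - m x3) (m x2 - m x3) x1 x2 x3 u1 = 0"
    unfolding tr[OF v(1)] by (rule first(1))
  show "frakB w1 w2 (m x1 - m x3) (m x2 - m x3) x1 x2 x3 u2 = 0"
    unfolding tr[OF v(2)] by (rule second(1))
  show "frakB w1 w2 (m x1 - m x3) (m x2 - m x3) x1 x2 x3 u3 = 0"
    unfolding tr[OF v(3)] by (rule third(1))
  show "(m x2 - m x3 + 2 * \<zeta> (u1 - x2) - 2 * \<zeta> (u1 - x3)) * (\<zeta> (x1 - x2) - \<zeta> (x3 - u1) + m x2 + m x3 + k)
      = (m x1 - m x3 + 2 * \<zeta> (u1 - x1) - 2 * \<zeta> (u1 - x3)) *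
        (\<zeta> (u1 - x3) - \<zeta> (u1 - x2) + \<zeta> (x1 - x2) - \<zeta> (x1 - x3))"
    unfolding k_def by (rule first(2))
  \<comment> \<open>The exchange replaces k by k' with zeta(z) in place of zeta(b), and stationarity
    is k + k' + m x1 + m x2 + m x3 = 0.\<close>
  have "\<zeta> (x1 - x2) - \<zeta> (x3 - u2) + m x2 + m x3
         + (\<zeta> z - 2 * \<zeta> c + \<zeta> (c - a x1) + \<zeta> (c - a x2) + \<zeta> (c - a x3))
      = \<zeta> (x1 - x2) - \<zeta> (x3 - u2) - k - m x1"
    using ks unfolding m k_def by algebra
  from second(2)[unfolded this]
  show "(m x2 - m x3 + 2 * \<zeta> (u2 - x2) - 2 * \<zeta> (u2 - x3)) * (\<zeta> (x1 - x2) - \<zeta> (x3 - u2) - k - m x1)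
      = (m x1 - m x3 + 2 * \<zeta> (u2 - x1) - 2 * \<zeta> (u2 - x3)) *
        (\<zeta> (u2 - x3) - \<zeta> (u2 - x2) + \<zeta> (x1 - x2) - \<zeta> (x1 - x3))" .
  show "(m x2 - m x3 + 2 * \<zeta> (u3 - x2) - 2 * \<zeta> (u3 - x3)) * (\<zeta> (x1 - x2) - \<zeta> (x3 - u3) - m x1)
      = (m x1 - m x3 + 2 * \<zeta> (u3 - x1) - 2 * \<zeta> (u3 - x3)) *
        (\<zeta> (u3 - x3) - \<zeta> (u3 - x2) + \<zeta> (x1 - x2) - \<zeta> (x1 - x3))"
    by (rule third(2))
qed

end

section \<open>The generating function\<close>

theorem theorem5p2:
  fixes w1 w2 g :: complex
    and zs :: "complex^4 \<Rightarrow> complex" and W :: "(complex^4) set"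
    and \<Omega> :: "(complex^6) set"
    and Fb L :: "complex^6 \<Rightarrow> complex"
  assumes lattice: "Im (w2 / w1) \<noteq> 0"
    and g: "g \<noteq> 0"
    and \<Omega>_open: "open \<Omega>"
    and zs_holo: "holo_on zs W"
    and tsv_W: "\<forall>p\<in>\<Omega>. tsv p \<in> W"
    and stationary: "\<forall>q\<in>W. ((\<lambda>z. kappa w1 w2 (q$1) (q$2) (q$3) (q$4) z)
                          has_field_derivative 0) (at (zs q))"
    and kappa_nz: "\<forall>q\<in>W. kappa w1 w2 (q$1) (q$2) (q$3) (q$4) (zs q) \<noteq> 0"
    and Fb_cont: "continuous_on \<Omega> Fb"
    and Fb_log: "\<forall>p\<in>\<Omega>. exp (Fb p) =
                   kappa w1 w2 (tsv p $ 1) (tsv p $ 2) (tsv p $ 3) (tsv p $ 4) (zs (tsv p))"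
    and L_cont: "continuous_on \<Omega> L"
    and L_log: "\<forall>p\<in>\<Omega>. exp (L p) =
                   (\<Prod>i\<leftarrow>[1,2,3]. wsigma w1 w2 (p$i)) /
                   ((\<Prod>j\<leftarrow>[1,2,3]. wsigma w1 w2 (uu j p)) *
                    wsigma w1 w2 (p$1 - p$2) * wsigma w1 w2 (p$1 - p$3) * wsigma w1 w2 (p$2 - p$3))"
    and generic: "\<forall>p\<in>\<Omega>. \<forall>i\<in>{1,2,3}. \<forall>j\<in>{1,2,3}. p$i - uu j p \<notin> wlattice w1 w2"
  shows "\<forall>p\<in>\<Omega>.
    (let F = (\<lambda>q. q$6 * xplus q + \<i> * g * L q + \<i> * g * Fb q);
         y = (\<lambda>i. cpartial F i p);
         v' = - cpartial F 4 p;
         v'' = - cpartial F 5 p;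
         vp = p$6;
         v3 = (vp - v' - v'') / 3;
         v = (\<lambda>j::nat. if j = 1 then v3 + v' else if j = 2 then v3 + v'' else v3);
         r1 = cpartial Fb 1 p - cpartial Fb 3 p;
         r2 = cpartial Fb 2 p - cpartial Fb 3 p;
         Z = wzeta w1 w2;
         x1 = p$1; x2 = p$2; x3 = p$3;
         rt1 = (\<lambda>u. r1 + 2 * Z (u - x1) - 2 * Z (u - x3));
         rt2 = (\<lambda>u. r2 + 2 * Z (u - x2) - 2 * Z (u - x3))
     in ((\<lambda>q. F q - q$6 * uplus q) has_derivative
           (\<lambda>h. y 1 * h$1 + y 2 * h$2 + y 3 * h$3 - vp * uplus h - v' * h$4 - v'' * h$5)) (at p)
      \<and> (\<forall>j\<in>{1,2,3::nat}. frakB w1 w2 r1 r2 x1 x2 x3 (uu j p) = 0)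
      \<and> (\<forall>j\<in>{1,2,3::nat}. rt2 (uu j p) \<noteq> 0 \<longrightarrow>
           v j = y 1 + \<i> * g * (Z (x3 - uu j p) + Z (uu j p) - Z x1 + Z (x1 - x3)
                 + rt1 (uu j p) / rt2 (uu j p) *
                   (Z (uu j p - x3) - Z (uu j p - x2) + Z (x1 - x2) - Z (x1 - x3)))))"
proof (rule ballI, goal_cases)
  case (1 p)
  note p = 1
  let ?Z = "wzeta w1 w2"
  define z where "z = zs (tsv p)"
  define c where "c = 2 * z + (uu2 p - uu1 p)"
  define a where "a x = z + (x - uu1 p)" for x
  \<comment> \<open>\<open>m (p$i)\<close> and \<open>k\<close> are the derivatives of log kappa in
    t_i and s; \<open>a (uu2 p)\<close> is z + s.\<close>
  define m where "m x = ?Z (a x) - ?Z (c - a x)" for x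
  define k where "k = ?Z (a (uu2 p)) - 2 * ?Z c + ?Z (c - a (p$1)) + ?Z (c - a (p$2)) + ?Z (c - a (p$3))"
  have W: "tsv p \<in> W" using tsv_W p by blast
  have zs_diff: "zs differentiable (at (tsv p))"
    using zs_holo W unfolding holo_on_def differentiable_on_def by (metis at_within_open)
  have stat: "((\<lambda>z. kappa w1 w2 (tsv p $ 1) (tsv p $ 2) (tsv p $ 3) (tsv p $ 4) z)
      has_field_derivative 0) (at (zs (tsv p)))"
    using stationary W by blast
  note nz = bspec[OF kappa_nz W, unfolded tsv_nth, folded z_def]
  note DL = log_prefactor_has_derivative[OF lattice \<Omega>_open p L_cont L_log]
  note DF = log_kappa_has_derivative[OF lattice \<Omega>_open p Fb_cont zs_diff Fb_log stat,
    folded z_def, folded c_def a_def, folded m_def k_def]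
  note y = generating_function_partials(3-6)[where g = "\<i> * g", OF DL(1) DF]
  note r = generating_function_partials(1,2)[OF DL(1) DF]
  have u3: "uu3 p = p$1 + p$2 + p$3 - uu1 p - uu2 p"
    by (simp add: uu1_def uu2_def uu3_def uplus_def xplus_def field_simps)
  have xu: "\<forall>x\<in>{p$1, p$2, p$3}. \<forall>u\<in>{uu1 p, uu2 p, uu3 p}. x - u \<notin> wlattice w1 w2"
    using bspec[OF generic p] unfolding ball_three uu_simps by blast
  note sep = separation_equations[OF lattice u3 nz stat[unfolded tsv_nth, folded z_def] xu DL(2-4),
    folded c_def a_def, folded m_def k_def]
  \<comment> \<open>For (c) the assumption that \<open>rt2\<close> is nonzero triggers
    \<open>quotient_momentum\<close>; \<open>sep\<close> supplies its product identity and
    \<open>y\<close> the value of v_j - y_1.\<close>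
  show ?case
    unfolding Let_def ball_three uu_simps if_three r
    by (intro conjI impI; (rule y(1) sep(1-3)
       | (erule quotient_momentum[rotated 2], rule sep, rule trans, rule y,
          rule arg_cong[of _ _ "\<lambda>x. \<i> * g * x"], simp)))
qed

end
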